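(* Let $R=\prod_{i=1}^m M_{n_i}(F_i)^{\kappa_i}$, where the $F_i$ are finite fields, $n_i\ge 1$ are integers, $\kappa_i$ are cardinal numbers, and the rings $M_{n_i}(F_i)$ are non-isomorphic for distinct $i$'s, with the product topology. Then the group of all topological automorphisms of $R$ is equal to $$\Big\{\Big(\prod_{i=1}^m f_{\sigma_i}\Big)\circ g:\ \sigma_i\in \mathrm{Sym}(\kappa_i)\ (1\le i\le m),\ g\in \prod_{i=1}^m \mathrm{Aut}(M_{n_i}(F_i))^{\kappa_i}\Big\},$$ where, for $\sigma\in \mathrm{Sym}(\kappa_i)$, $f_\sigma$ is the automorphism of $M_{n_i}(F_i)^{\kappa_i}$ given by $f_\sigma(x)(\alpha)=x(\sigma^{-1}(\alpha))$. Hence, this group is isomorphic to the semidirect product of $\prod_i \mathrm{Sym}(\kappa_i)$ and $\prod_i \mathrm{Aut}(M_{n_i}(F_i))^{\kappa_i}$. Consequently, if $(R,G)$ is a small compact $G$-ring, then $G$, treated as a group of permutations of $R$, is a subgroup of the group of all topological automorphisms of $R$, i.e. of the group of all maps $\big(\prod_{i=1}^m f_{\sigma_i}\big)\circ g$ with $\sigma_i\in \mathrm{Sym}(\kappa_i)$ $(1\le i\le m)$ and $g\in \prod_{i=1}^m \mathrm{Aut}(M_{n_i}(F_i))^{\kappa_i}$, acting on $R$ in the natural way.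
   Context: A topological automorphism is a ring automorphism which is also a homeomorphism. $M_k(F)$ is the ring of all $k\times k$ matrices over $F$ (finite, with the discrete topology), and $\mathrm{Aut}(M_k(F))$ is its group of ring automorphisms. $\mathrm{Sym}(\kappa)$ is the group of all permutations of $\kappa$. An element $g\in\prod_i \mathrm{Aut}(M_{n_i}(F_i))^{\kappa_i}$ acts on $R$ coordinatewise, and $\prod_i f_{\sigma_i}$ acts on $R$ by applying $f_{\sigma_i}$ to the factor $M_{n_i}(F_i)^{\kappa_i}$. In the semidirect product, $\prod_i\mathrm{Aut}(M_{n_i}(F_i))^{\kappa_i}$ is the normal factor and $\prod_i\mathrm{Sym}(\kappa_i)$ acts on it by permuting coordinates. A compact $G$-ring is a pair $(R,G)$, where $G$ is a Polish group, $R$ is a compact (Hausdorff) topological ring, and $G$ acts continuously on $R$ as a group of ring automorphisms. It is small if for every $n<\omega$ there are only countably many orbits of the action of $G$ on $R^{\times n}$ (the set of $n$-tuples). The rings $R$ of the form considered are, up to isomorphism of topological rings, exactly the products of complete matrix rings over finite fields of cardinality bounded by a common finite number. *)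

theory Defs
  imports
    "HOL-Algebra.Group_Action"
    "HOL-Algebra.Product_Groups"
    "HOL-Algebra.QuotRing"
    "HOL-Analysis.Abstract_Metric_Spaces"
    "HOL-Analysis.Product_Topology"
    "Jordan_Normal_Form.Matrix"
begin

section \<open>Rings\<close>

text \<open>The library's \<open>ring_mat\<close> is the matrix ring over a type class; here the
  coefficient ring is a record, so that a family of fields may vary with its index.\<close>

definition matrix_ring :: "('a, 'b) ring_scheme \<Rightarrow> nat \<Rightarrow> 'a mat ring" where
  "matrix_ring F n = \<lparr>
     carrier = {A \<in> carrier_mat n n. elements_mat A \<subseteq> carrier F},
     monoid.mult = (\<lambda>A B. mat n n (\<lambda>(i, j). \<Oplus>\<^bsub>F\<^esub>k\<in>{..<n}. A $$ (i, k) \<otimes>\<^bsub>F\<^esub> B $$ (k, j))),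
     one = mat n n (\<lambda>(i, j). if i = j then \<one>\<^bsub>F\<^esub> else \<zero>\<^bsub>F\<^esub>),
     zero = mat n n (\<lambda>_. \<zero>\<^bsub>F\<^esub>),
     add = (\<lambda>A B. mat n n (\<lambda>ij. A $$ ij \<oplus>\<^bsub>F\<^esub> B $$ ij))\<rparr>"

definition product_ring :: "'i set \<Rightarrow> ('i \<Rightarrow> ('a, 'b) ring_scheme) \<Rightarrow> ('i \<Rightarrow> 'a) ring" where
  "product_ring I R = \<lparr>
     carrier = (\<Pi>\<^sub>E i\<in>I. carrier (R i)),
     monoid.mult = (\<lambda>x y. \<lambda>i\<in>I. x i \<otimes>\<^bsub>R i\<^esub> y i),
     one = (\<lambda>i\<in>I. \<one>\<^bsub>R i\<^esub>),
     zero = (\<lambda>i\<in>I. \<zero>\<^bsub>R i\<^esub>),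
     add = (\<lambda>x y. \<lambda>i\<in>I. x i \<oplus>\<^bsub>R i\<^esub> y i)\<rparr>"

text \<open>The cardinal \<open>\<kappa>\<^sub>i\<close> is represented by an arbitrary index set \<open>K i\<close>.\<close>

definition matrix_product_ring ::
  "nat \<Rightarrow> (nat \<Rightarrow> ('a, 'b) ring_scheme) \<Rightarrow> (nat \<Rightarrow> nat) \<Rightarrow> (nat \<Rightarrow> 'k set) \<Rightarrow>
    (nat \<Rightarrow> 'k \<Rightarrow> 'a mat) ring" where
  "matrix_product_ring m F n K =
     product_ring {1..m} (\<lambda>i. product_ring (K i) (\<lambda>_. matrix_ring (F i) (n i)))"

definition matrix_product_topology ::
  "nat \<Rightarrow> (nat \<Rightarrow> ('a, 'b) ring_scheme) \<Rightarrow> (nat \<Rightarrow> nat) \<Rightarrow> (nat \<Rightarrow> 'k set) \<Rightarrow>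
    (nat \<Rightarrow> 'k \<Rightarrow> 'a mat) topology" where
  "matrix_product_topology m F n K =
     product_topology (\<lambda>i. product_topology
       (\<lambda>_. discrete_topology (carrier (matrix_ring (F i) (n i)))) (K i)) {1..m}"


section \<open>Automorphism groups\<close>

text \<open>As in \<open>HOL-Algebra.Bij\<close>, automorphisms are extensional functions, so that equality of
  automorphisms is equality on the carrier.\<close>

definition ring_autos :: "('a, 'b) ring_scheme \<Rightarrow> ('a \<Rightarrow> 'a) set" where
  "ring_autos R = Ring.ring_hom R R \<inter> Bij (carrier R)"

definition ring_auto_group :: "('a, 'b) ring_scheme \<Rightarrow> ('a \<Rightarrow> 'a) monoid" where
  "ring_auto_group R = BijGroup (carrier R) \<lparr>carrier := ring_autos R\<rparr>"

definition topological_ring_autos :: "('a, 'b) ring_scheme \<Rightarrow> 'a topology \<Rightarrow> ('a \<Rightarrow> 'a) set" where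
  "topological_ring_autos R T = {h \<in> ring_autos R. homeomorphic_map T T h}"

definition topological_ring_auto_group ::
  "('a, 'b) ring_scheme \<Rightarrow> 'a topology \<Rightarrow> ('a \<Rightarrow> 'a) monoid" where
  "topological_ring_auto_group R T = BijGroup (carrier R) \<lparr>carrier := topological_ring_autos R T\<rparr>"

definition Sym_product :: "nat \<Rightarrow> (nat \<Rightarrow> 'k set) \<Rightarrow> (nat \<Rightarrow> 'k \<Rightarrow> 'k) monoid" where
  "Sym_product m K = product_group {1..m} (\<lambda>i. BijGroup (K i))"

definition Aut_product ::
  "nat \<Rightarrow> (nat \<Rightarrow> ('a, 'b) ring_scheme) \<Rightarrow> (nat \<Rightarrow> nat) \<Rightarrow> (nat \<Rightarrow> 'k set) \<Rightarrow>
    (nat \<Rightarrow> 'k \<Rightarrow> 'a mat \<Rightarrow> 'a mat) monoid" where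
  "Aut_product m F n K =
     product_group {1..m} (\<lambda>i. product_group (K i) (\<lambda>_. ring_auto_group (matrix_ring (F i) (n i))))"


section \<open>Coordinate permutations and coordinatewise automorphisms\<close>

definition coord_perm :: "'k set \<Rightarrow> ('k \<Rightarrow> 'k) \<Rightarrow> ('k \<Rightarrow> 'x) \<Rightarrow> 'k \<Rightarrow> 'x" where
  "coord_perm K \<sigma> x = (\<lambda>\<alpha>\<in>K. x (inv_into K \<sigma> \<alpha>))"

text \<open>Polymorphic in \<open>'x\<close>: it serves both as the map \<open>\<Prod>\<^sub>i f\<^bsub>\<sigma>\<^sub>i\<^esub>\<close> on ring elements (families of
  matrices) and as the action of \<open>\<Prod>\<^sub>i Sym(\<kappa>\<^sub>i)\<close> on families of automorphisms, where it is conjugation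
  by \<open>\<Prod>\<^sub>i f\<^bsub>\<sigma>\<^sub>i\<^esub>\<close>.\<close>

definition coord_perms ::
  "nat \<Rightarrow> (nat \<Rightarrow> 'k set) \<Rightarrow> (nat \<Rightarrow> 'k \<Rightarrow> 'k) \<Rightarrow> (nat \<Rightarrow> 'k \<Rightarrow> 'x) \<Rightarrow> nat \<Rightarrow> 'k \<Rightarrow> 'x" where
  "coord_perms m K \<sigma> x = (\<lambda>i\<in>{1..m}. coord_perm (K i) (\<sigma> i) (x i))"

definition coordwise ::
  "nat \<Rightarrow> (nat \<Rightarrow> 'k set) \<Rightarrow> (nat \<Rightarrow> 'k \<Rightarrow> 'x \<Rightarrow> 'x) \<Rightarrow> (nat \<Rightarrow> 'k \<Rightarrow> 'x) \<Rightarrow> nat \<Rightarrow> 'k \<Rightarrow> 'x" where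
  "coordwise m K g x = (\<lambda>i\<in>{1..m}. \<lambda>\<alpha>\<in>K i. g i \<alpha> (x i \<alpha>))"

definition permuted_coordwise_autos ::
  "nat \<Rightarrow> (nat \<Rightarrow> ('a, 'b) ring_scheme) \<Rightarrow> (nat \<Rightarrow> nat) \<Rightarrow> (nat \<Rightarrow> 'k set) \<Rightarrow>
    ((nat \<Rightarrow> 'k \<Rightarrow> 'a mat) \<Rightarrow> (nat \<Rightarrow> 'k \<Rightarrow> 'a mat)) set" where
  "permuted_coordwise_autos m F n K =
     {compose (carrier (matrix_product_ring m F n K)) (coord_perms m K \<sigma>) (coordwise m K g) | \<sigma> g.
        \<sigma> \<in> carrier (Sym_product m K) \<and> g \<in> carrier (Aut_product m F n K)}"

text \<open>\<open>N\<close> is the normal factor and \<open>H\<close> acts on it through \<open>\<theta>\<close>.\<close>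

definition semidirect_product ::
  "('n, 'b) monoid_scheme \<Rightarrow> ('h, 'c) monoid_scheme \<Rightarrow> ('h \<Rightarrow> 'n \<Rightarrow> 'n) \<Rightarrow> ('n \<times> 'h) monoid" where
  "semidirect_product N H \<theta> = \<lparr>
     carrier = carrier N \<times> carrier H,
     monoid.mult = (\<lambda>(a, h) (b, k). (a \<otimes>\<^bsub>N\<^esub> \<theta> h b, h \<otimes>\<^bsub>H\<^esub> k)),
     one = (\<one>\<^bsub>N\<^esub>, \<one>\<^bsub>H\<^esub>)\<rparr>"


section \<open>Compact \<open>G\<close>-rings\<close>

locale polish_group = group G for G (structure) and S +
  assumes topspace_group: "topspace S = carrier G"
    and continuous_mult: "continuous_map (prod_topology S S) S (\<lambda>(x, y). x \<otimes> y)"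
    and continuous_inv: "continuous_map S S (\<lambda>x. inv x)"
    and second_countable: "second_countable S"
    and completely_metrizable: "completely_metrizable_space S"

locale compact_topological_ring = ring R for R (structure) and T +
  assumes topspace_ring: "topspace T = carrier R"
    and continuous_add: "continuous_map (prod_topology T T) T (\<lambda>(x, y). x \<oplus> y)"
    and continuous_minus: "continuous_map T T (\<lambda>x. \<ominus> x)"
    and continuous_ring_mult: "continuous_map (prod_topology T T) T (\<lambda>(x, y). x \<otimes> y)"
    and compact: "compact_space T"
    and Hausdorff: "Hausdorff_space T"

locale compact_G_ring =
  compact_topological_ring R T + polish_group G S + group_action G "carrier R" \<phi>
  for R (structure) and T and G (structure) and S and \<phi> +
  assumes acts_by_ring_autos: "g \<in> carrier G \<Longrightarrow> \<phi> g \<in> ring_autos R"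
    and continuous_action: "continuous_map (prod_topology S T) T (\<lambda>(g, x). \<phi> g x)"

definition tuple_action ::
  "nat \<Rightarrow> ('g \<Rightarrow> 'x \<Rightarrow> 'x) \<Rightarrow> 'g \<Rightarrow> (nat \<Rightarrow> 'x) \<Rightarrow> nat \<Rightarrow> 'x" where
  "tuple_action n \<phi> g x = (\<lambda>k\<in>{..<n}. \<phi> g (x k))"

locale small_compact_G_ring = compact_G_ring +
  assumes small: "\<And>n. countable (orbits G ({..<n} \<rightarrow>\<^sub>E carrier R) (tuple_action n \<phi>))"

end

theory Submission
  imports Defs
begin

text \<open>A coordinate of a topological automorphism \<open>h\<close> is a continuous homomorphism from \<open>R\<close> onto a
  discrete simple ring \<open>M\<close>. Its kernel is open, so it contains all elements that vanish on some finite
  set of coordinates. The unit idempotents of these finitely many coordinates have central idempotent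
  images in \<open>M\<close>, and these cannot all be zero; since \<open>M\<close> is simple, one of them is the identity, and the
  homomorphism then depends on that coordinate alone. By simplicity it induces an isomorphism from that
  factor onto \<open>M\<close>, so both factors are of the same type \<open>i\<close>. Treating \<open>h\<^sup>-\<^sup>1\<close> in the same way shows
  that the resulting map on each index set \<open>\<kappa>\<^sub>i\<close> is a bijection.\<close>

section \<open>Simplicity of matrix rings\<close>

text \<open>Continuity is what confines a homomorphism to finitely many coordinates. For infinite
  \<open>K i\<close>, a nonprincipal ultrafilter on \<open>K i\<close> defines, by taking limits
  along it, a ring homomorphism from the power onto the finite ring
  \<open>matrix_ring (F i) (n i)\<close>. This map kills every element of finite support, so it
  depends on no single coordinate; it is not continuous. A second issue is the order of composition.
  The set in the theorem applies the coordinatewise automorphisms before the permutations, while the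
  multiplication of the semidirect product fits the opposite order. Moving a permutation past a
  family of automorphisms permutes that family, so both orders describe the same maps. The work is
  done in the second order and transferred at the end.\<close>

lemma (in abelian_monoid) finsum_swap:
  assumes "finite A" "finite B" "\<And>i j. i \<in> A \<Longrightarrow> j \<in> B \<Longrightarrow> f i j \<in> carrier G"
  shows "(\<Oplus>i\<in>A. \<Oplus>j\<in>B. f i j) = (\<Oplus>j\<in>B. \<Oplus>i\<in>A. f i j)"
  using assms(1,3)
proof (induction A)
  case empty
  then show ?case by simp
next
  case (insert a A)
  have "(\<Oplus>j\<in>B. \<Oplus>i\<in>insert a A. f i j) = (\<Oplus>j\<in>B. f a j \<oplus> (\<Oplus>i\<in>A. f i j))"
    using insert by (intro finsum_cong') auto
  also have "\<dots> = (\<Oplus>j\<in>B. f a j) \<oplus> (\<Oplus>j\<in>B. \<Oplus>i\<in>A. f i j)"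
    using insert by (intro finsum_addf) auto
  also have "\<dots> = (\<Oplus>i\<in>insert a A. \<Oplus>j\<in>B. f i j)"
    using insert by (subst finsum_insert) auto
  finally show ?case ..
qed

lemma carrier_matrix_ring:
  "A \<in> carrier (matrix_ring F n) \<longleftrightarrow>
     A \<in> carrier_mat n n \<and> (\<forall>i<n. \<forall>j<n. A $$ (i, j) \<in> carrier F)"
  by (fastforce simp: matrix_ring_def elements_mat_def)

lemma matrix_ring_eqI:
  assumes "A \<in> carrier (matrix_ring F n)" "B \<in> carrier (matrix_ring F n)"
    and "\<And>i j. i < n \<Longrightarrow> j < n \<Longrightarrow> A $$ (i, j) = B $$ (i, j)"
  shows "A = B"
  using assms by (intro eq_matI) (auto simp: carrier_matrix_ring)

lemma mat_in_matrix_ring: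
  "(\<And>i j. i < n \<Longrightarrow> j < n \<Longrightarrow> f (i, j) \<in> carrier F) \<Longrightarrow> mat n n f \<in> carrier (matrix_ring F n)"
  by (auto simp: carrier_matrix_ring)

lemma index_matrix_ring [simp]:
  assumes "i < n" "j < n"
  shows "(A \<otimes>\<^bsub>matrix_ring F n\<^esub> B) $$ (i, j) = (\<Oplus>\<^bsub>F\<^esub>k\<in>{..<n}. A $$ (i, k) \<otimes>\<^bsub>F\<^esub> B $$ (k, j))"
    and "(A \<oplus>\<^bsub>matrix_ring F n\<^esub> B) $$ (i, j) = A $$ (i, j) \<oplus>\<^bsub>F\<^esub> B $$ (i, j)"
    and "\<one>\<^bsub>matrix_ring F n\<^esub> $$ (i, j) = (if i = j then \<one>\<^bsub>F\<^esub> else \<zero>\<^bsub>F\<^esub>)"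
    and "\<zero>\<^bsub>matrix_ring F n\<^esub> $$ (i, j) = \<zero>\<^bsub>F\<^esub>"
  using assms by (auto simp: matrix_ring_def)

context ring
begin

lemma matrix_ring_closed:
  shows "A \<in> carrier (matrix_ring R n) \<Longrightarrow> B \<in> carrier (matrix_ring R n) \<Longrightarrow>
      A \<otimes>\<^bsub>matrix_ring R n\<^esub> B \<in> carrier (matrix_ring R n)"
    and "A \<in> carrier (matrix_ring R n) \<Longrightarrow> B \<in> carrier (matrix_ring R n) \<Longrightarrow>
      A \<oplus>\<^bsub>matrix_ring R n\<^esub> B \<in> carrier (matrix_ring R n)"
    and "\<one>\<^bsub>matrix_ring R n\<^esub> \<in> carrier (matrix_ring R n)"
    and "\<zero>\<^bsub>matrix_ring R n\<^esub> \<in> carrier (matrix_ring R n)"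
  by (auto simp: carrier_matrix_ring intro!: finsum_closed) (auto simp: matrix_ring_def)

lemma ring_matrix_ring: "ring (matrix_ring R n)"
proof (rule ringI)
  let ?M = "matrix_ring R n"
  note closed = matrix_ring_closed
  have entry [simp]: "A $$ (i, j) \<in> carrier R" if "A \<in> carrier ?M" "i < n" "j < n" for A i j
    using that by (auto simp: carrier_matrix_ring)
  show "abelian_group ?M"
  proof (rule abelian_groupI)
    fix A assume A: "A \<in> carrier ?M"
    show "\<exists>B\<in>carrier ?M. B \<oplus>\<^bsub>?M\<^esub> A = \<zero>\<^bsub>?M\<^esub>"
    proof
      show B: "mat n n (\<lambda>ij. \<ominus> (A $$ ij)) \<in> carrier ?M"
        using A by (auto intro!: mat_in_matrix_ring)
      show "mat n n (\<lambda>ij. \<ominus> (A $$ ij)) \<oplus>\<^bsub>?M\<^esub> A = \<zero>\<^bsub>?M\<^esub>"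
        using A B by (intro matrix_ring_eqI[of _ R n] closed) (auto simp: l_neg)
    qed
  qed (auto intro!: closed matrix_ring_eqI[of _ R n] simp: a_ac)
  show "Group.monoid ?M"
  proof (rule monoidI)
    fix A B C assume ABC: "A \<in> carrier ?M" "B \<in> carrier ?M" "C \<in> carrier ?M"
    show "A \<otimes>\<^bsub>?M\<^esub> B \<otimes>\<^bsub>?M\<^esub> C = A \<otimes>\<^bsub>?M\<^esub> (B \<otimes>\<^bsub>?M\<^esub> C)"
    proof (rule matrix_ring_eqI[of _ R n])
      fix i j assume ij: "i < n" "j < n"
      have "(A \<otimes>\<^bsub>?M\<^esub> B \<otimes>\<^bsub>?M\<^esub> C) $$ (i, j)
          = (\<Oplus>k\<in>{..<n}. \<Oplus>l\<in>{..<n}. A $$ (i, l) \<otimes> B $$ (l, k) \<otimes> C $$ (k, j))"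
        using ABC ij by (simp, intro finsum_cong') (auto intro!: finsum_ldistr finsum_closed)
      \<comment> \<open>The two bracketings expand to the same double sum, up to the order of
        summation.\<close>
      also have "\<dots> = (\<Oplus>l\<in>{..<n}. \<Oplus>k\<in>{..<n}. A $$ (i, l) \<otimes> B $$ (l, k) \<otimes> C $$ (k, j))"
        using ABC ij by (intro finsum_swap) auto
      also have "\<dots> = (\<Oplus>l\<in>{..<n}. A $$ (i, l) \<otimes> (\<Oplus>k\<in>{..<n}. B $$ (l, k) \<otimes> C $$ (k, j)))"
        using ABC ij
        by (intro finsum_cong') (auto simp: finsum_rdistr m_assoc intro!: finsum_cong' finsum_closed)
      also have "\<dots> = (A \<otimes>\<^bsub>?M\<^esub> (B \<otimes>\<^bsub>?M\<^esub> C)) $$ (i, j)"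
        using ABC ij by (simp, intro finsum_cong') (auto intro!: finsum_closed)
      finally show "(A \<otimes>\<^bsub>?M\<^esub> B \<otimes>\<^bsub>?M\<^esub> C) $$ (i, j) = (A \<otimes>\<^bsub>?M\<^esub> (B \<otimes>\<^bsub>?M\<^esub> C)) $$ (i, j)" .
    qed (use ABC closed in auto)
  next
    fix A assume A: "A \<in> carrier ?M"
    show "\<one>\<^bsub>?M\<^esub> \<otimes>\<^bsub>?M\<^esub> A = A"
    proof (rule matrix_ring_eqI[of _ R n])
      fix i j assume ij: "i < n" "j < n"
      have "(\<one>\<^bsub>?M\<^esub> \<otimes>\<^bsub>?M\<^esub> A) $$ (i, j) = (\<Oplus>k\<in>{..<n}. if i = k then A $$ (k, j) else \<zero>)"
        using A ij by (simp, intro finsum_cong') auto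
      also have "\<dots> = A $$ (i, j)"
        using A ij by (intro finsum_singleton) auto
      finally show "(\<one>\<^bsub>?M\<^esub> \<otimes>\<^bsub>?M\<^esub> A) $$ (i, j) = A $$ (i, j)" .
    qed (use A closed in auto)
    show "A \<otimes>\<^bsub>?M\<^esub> \<one>\<^bsub>?M\<^esub> = A"
    proof (rule matrix_ring_eqI[of _ R n])
      fix i j assume ij: "i < n" "j < n"
      have "(A \<otimes>\<^bsub>?M\<^esub> \<one>\<^bsub>?M\<^esub>) $$ (i, j) = (\<Oplus>k\<in>{..<n}. if j = k then A $$ (i, k) else \<zero>)"
        using A ij by (simp, intro finsum_cong') auto
      also have "\<dots> = A $$ (i, j)"
        using A ij by (intro finsum_singleton) auto
      finally show "(A \<otimes>\<^bsub>?M\<^esub> \<one>\<^bsub>?M\<^esub>) $$ (i, j) = A $$ (i, j)" .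
    qed (use A closed in auto)
  qed (use closed in auto)
  show "(A \<oplus>\<^bsub>?M\<^esub> B) \<otimes>\<^bsub>?M\<^esub> C = A \<otimes>\<^bsub>?M\<^esub> C \<oplus>\<^bsub>?M\<^esub> B \<otimes>\<^bsub>?M\<^esub> C"
    "C \<otimes>\<^bsub>?M\<^esub> (A \<oplus>\<^bsub>?M\<^esub> B) = C \<otimes>\<^bsub>?M\<^esub> A \<oplus>\<^bsub>?M\<^esub> C \<otimes>\<^bsub>?M\<^esub> B"
    if ABC: "A \<in> carrier ?M" "B \<in> carrier ?M" "C \<in> carrier ?M" for A B C
  proof -
    show "(A \<oplus>\<^bsub>?M\<^esub> B) \<otimes>\<^bsub>?M\<^esub> C = A \<otimes>\<^bsub>?M\<^esub> C \<oplus>\<^bsub>?M\<^esub> B \<otimes>\<^bsub>?M\<^esub> C"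
      using ABC
      by (intro matrix_ring_eqI[of _ R n] closed)
        (auto simp: l_distr simp flip: finsum_addf intro!: finsum_cong')
    show "C \<otimes>\<^bsub>?M\<^esub> (A \<oplus>\<^bsub>?M\<^esub> B) = C \<otimes>\<^bsub>?M\<^esub> A \<oplus>\<^bsub>?M\<^esub> C \<otimes>\<^bsub>?M\<^esub> B"
      using ABC
      by (intro matrix_ring_eqI[of _ R n] closed)
        (auto simp: r_distr simp flip: finsum_addf intro!: finsum_cong')
  qed
qed

end

text \<open>The \<open>(0, 0)\<close> entries differ; that such an entry exists is the content of
  \<open>n \<ge> 1\<close>.\<close>

lemma (in ring) matrix_ring_one_not_zero:
  assumes "\<one> \<noteq> \<zero>" "n \<ge> 1"
  shows "\<one>\<^bsub>matrix_ring R n\<^esub> \<noteq> \<zero>\<^bsub>matrix_ring R n\<^esub>"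
  using index_matrix_ring(3,4)[of 0 n 0 R] assms by (metis One_nat_def Suc_le_lessD)

text \<open>A two-sided ideal containing the unit is the whole ring, so this is the usual absence of
  proper nonzero ideals, in the form in which it is applied below.\<close>

definition simple_ring :: "('a, 'b) ring_scheme \<Rightarrow> bool" where
  "simple_ring R \<longleftrightarrow> ring R \<and> \<one>\<^bsub>R\<^esub> \<noteq> \<zero>\<^bsub>R\<^esub> \<and>
     (\<forall>I x. ideal I R \<longrightarrow> x \<in> I \<longrightarrow> x \<noteq> \<zero>\<^bsub>R\<^esub> \<longrightarrow> \<one>\<^bsub>R\<^esub> \<in> I)"

lemma (in field) simple_matrix_ring:
  assumes n: "n \<ge> 1"
  shows "simple_ring (matrix_ring R n)"
  unfolding simple_ring_def
proof (intro conjI allI impI)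
  let ?M = "matrix_ring R n"
  interpret M: ring ?M by (rule ring_matrix_ring)
  show "ring ?M" ..
  show "\<one>\<^bsub>?M\<^esub> \<noteq> \<zero>\<^bsub>?M\<^esub>"
    using n by (intro matrix_ring_one_not_zero) auto
  fix I A assume "ideal I ?M" and AI: "A \<in> I" and A0: "A \<noteq> \<zero>\<^bsub>?M\<^esub>"
  interpret I: ideal I ?M by fact
  have A: "A \<in> carrier ?M" using AI by (rule I.Icarr)
  then have entry [simp]: "A $$ (i, j) \<in> carrier R" if "i < n" "j < n" for i j
    using that by (auto simp: carrier_matrix_ring)
  obtain p q where pq: "p < n" "q < n" "A $$ (p, q) \<noteq> \<zero>"
    using A0 matrix_ring_eqI[OF A M.zero_closed] by auto
  define c where "c = inv (A $$ (p, q))"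
  have c: "c \<in> carrier R" "c \<otimes> A $$ (p, q) = \<one>"
    using pq field_Units by (auto simp: c_def)
  define E where "E a i j = mat n n (\<lambda>ij. if ij = (i, j) then a else \<zero>)" for a i j
  have E [simp]: "E a i j \<in> carrier ?M" if "a \<in> carrier R" for a i j
    using that by (auto simp: E_def intro!: mat_in_matrix_ring)
  \<comment> \<open>Sandwiching \<open>A\<close> between matrix units isolates its \<open>(p, q)\<close> entry at any diagonal position,
    so the identity matrix is built up in \<open>I\<close> one diagonal entry at a time.\<close>
  define D where "D t = mat n n (\<lambda>(i, j). if i = j \<and> i < t then \<one> else \<zero>)" for t
  have D [simp]: "D t \<in> carrier ?M" for t
    by (auto simp: D_def intro!: mat_in_matrix_ring)
  have "D t \<in> I" if "t \<le> n" for t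
    using that
  proof (induction t)
    case 0
    have "D 0 = \<zero>\<^bsub>?M\<^esub>"
      by (rule matrix_ring_eqI[of _ R n]) (auto, simp add: D_def)
    then show ?case by simp
  next
    case (Suc t)
    \<comment> \<open>Left multiplication by \<open>E c t p\<close> moves row \<open>p\<close> to
      row \<open>t\<close>, scaled by \<open>c\<close>, and clears all other rows. The fact
      \<open>right\<close> does the same for columns, from \<open>q\<close> to \<open>t\<close>.
      Since \<open>c\<close> inverts the entry at \<open>(p, q)\<close>, the sandwich is the matrix
      unit at \<open>(t, t)\<close>.\<close>
    have left: "(E c t p \<otimes>\<^bsub>?M\<^esub> A) $$ (i, j) = (if i = t then c \<otimes> A $$ (p, j) else \<zero>)"
      if "i < n" "j < n" for i j
    proof -
      have "(E c t p \<otimes>\<^bsub>?M\<^esub> A) $$ (i, j)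
          = (\<Oplus>k\<in>{..<n}. if p = k then (if i = t then c \<otimes> A $$ (k, j) else \<zero>) else \<zero>)"
        using that c by (simp add: E_def, intro finsum_cong') auto
      also have "\<dots> = (if i = t then c \<otimes> A $$ (p, j) else \<zero>)"
        using that pq c by (intro finsum_singleton) auto
      finally show ?thesis .
    qed
    have right: "(B \<otimes>\<^bsub>?M\<^esub> E \<one> q t) $$ (i, j) = (if j = t then B $$ (i, q) else \<zero>)"
      if "i < n" "j < n" "B \<in> carrier ?M" for i j B
    proof -
      have B [simp]: "B $$ (i, k) \<in> carrier R" if "k < n" for k
        using that \<open>i < n\<close> \<open>B \<in> carrier ?M\<close> by (auto simp: carrier_matrix_ring)
      have "(B \<otimes>\<^bsub>?M\<^esub> E \<one> q t) $$ (i, j)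
          = (\<Oplus>k\<in>{..<n}. if q = k then (if j = t then B $$ (i, k) else \<zero>) else \<zero>)"
        using that c by (simp add: E_def, intro finsum_cong') auto
      also have "\<dots> = (if j = t then B $$ (i, q) else \<zero>)"
        using that pq c by (intro finsum_singleton) auto
      finally show ?thesis .
    qed
    have "E c t p \<otimes>\<^bsub>?M\<^esub> A \<otimes>\<^bsub>?M\<^esub> E \<one> q t \<in> I"
      using AI c by (intro I.I_l_closed I.I_r_closed) auto
    moreover have "D (Suc t) = D t \<oplus>\<^bsub>?M\<^esub> (E c t p \<otimes>\<^bsub>?M\<^esub> A \<otimes>\<^bsub>?M\<^esub> E \<one> q t)"
    proof (rule matrix_ring_eqI[of _ R n])
      fix i j assume ij: "i < n" "j < n"
      have "(E c t p \<otimes>\<^bsub>?M\<^esub> A \<otimes>\<^bsub>?M\<^esub> E \<one> q t) $$ (i, j) = (if i = t \<and> j = t then \<one> else \<zero>)"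
        using ij A c pq by (auto simp: right left simp del: index_matrix_ring)
      then show "D (Suc t) $$ (i, j)
          = (D t \<oplus>\<^bsub>?M\<^esub> (E c t p \<otimes>\<^bsub>?M\<^esub> A \<otimes>\<^bsub>?M\<^esub> E \<one> q t)) $$ (i, j)"
        using ij by (auto simp: D_def simp del: index_matrix_ring(1))
    qed (use A c in auto)
    ultimately show ?case
      using Suc by simp
  qed
  then have "D n \<in> I" by simp
  also have "D n = \<one>\<^bsub>?M\<^esub>"
    by (rule matrix_ring_eqI[of _ R n]) (simp_all, simp_all add: D_def)
  finally show "\<one>\<^bsub>?M\<^esub> \<in> I" .
qed

text \<open>The elements fixed by right multiplication with \<open>e\<close> form a left ideal, and
  centrality of \<open>e\<close> makes it two-sided. It contains \<open>e\<close>, hence the unit by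
  simplicity, and the unit being fixed means that it equals \<open>e\<close>.\<close>

lemma (in ring) simple_ring_central_idempotent:
  assumes "simple_ring R" and e: "e \<in> carrier R" "e \<otimes> e = e"
    and central: "\<And>x. x \<in> carrier R \<Longrightarrow> e \<otimes> x = x \<otimes> e" and "e \<noteq> \<zero>"
  shows "e = \<one>"
proof -
  let ?I = "{x \<in> carrier R. x \<otimes> e = x}"
  have "ideal ?I R"
  proof (rule idealI)
    show "subgroup ?I (add_monoid R)"
    proof (rule add.subgroupI)
      show "\<ominus> x \<in> ?I" if "x \<in> ?I" for x
        using that e(1) by (simp add: l_minus)
      show "x \<oplus> y \<in> ?I" if "x \<in> ?I" "y \<in> ?I" for x y
        using that e(1) by (simp add: l_distr)
      show "?I \<noteq> {}" using e by blast
    qed auto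
    fix a x assume a: "a \<in> ?I" and x: "x \<in> carrier R"
    then have "x \<otimes> a \<otimes> e = x \<otimes> a"
      using e(1) by (simp add: m_assoc)
    then show "x \<otimes> a \<in> ?I" using a x by simp
    have "a \<otimes> x \<otimes> e = a \<otimes> (e \<otimes> x)"
      using a x e(1) central[OF x] by (simp add: m_assoc)
    also have "\<dots> = a \<otimes> e \<otimes> x"
      using a x e(1) by (intro m_assoc[symmetric]) auto
    finally show "a \<otimes> x \<in> ?I" using a x by simp
  qed (rule ring_axioms)
  moreover have "e \<in> ?I" using e by simp
  ultimately have "\<one> \<in> ?I"
    using assms(1,5) unfolding simple_ring_def by blast
  then show ?thesis using e by simp
qed

text \<open>A nonzero kernel would contain the unit by simplicity, and then unit and zero would
  coincide in \<open>B\<close>.\<close>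

lemma simple_ring_hom_inj:
  assumes "simple_ring A" "ring B" "\<one>\<^bsub>B\<^esub> \<noteq> \<zero>\<^bsub>B\<^esub>" "f \<in> Ring.ring_hom A B"
  shows "inj_on f (carrier A)"
proof -
  interpret ring_hom_ring A B f
    using assms by (intro ring_hom_ringI2) (auto simp: simple_ring_def)
  have "x = \<zero>\<^bsub>A\<^esub>" if "x \<in> a_kernel A B f" for x
  proof (rule ccontr)
    assume "x \<noteq> \<zero>\<^bsub>A\<^esub>"
    then have "\<one>\<^bsub>A\<^esub> \<in> a_kernel A B f"
      using assms(1) kernel_is_ideal that unfolding simple_ring_def by blast
    then have "f \<one>\<^bsub>A\<^esub> = \<zero>\<^bsub>B\<^esub>"
      unfolding a_kernel_def' by blast
    then show False
      using assms(3) hom_one by metis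
  qed
  moreover have "\<zero>\<^bsub>A\<^esub> \<in> a_kernel A B f"
    unfolding a_kernel_def' using R.zero_closed hom_zero by blast
  ultimately have "a_kernel A B f = {\<zero>\<^bsub>A\<^esub>}"
    by blast
  then show ?thesis
    by (rule trivial_ker_imp_inj)
qed

section \<open>Homomorphisms from a product ring to a simple ring\<close>

lemma product_ring_simps [simp]:
  "carrier (product_ring I R) = (\<Pi>\<^sub>E i\<in>I. carrier (R i))"
  "x \<otimes>\<^bsub>product_ring I R\<^esub> y = (\<lambda>i\<in>I. x i \<otimes>\<^bsub>R i\<^esub> y i)"
  "x \<oplus>\<^bsub>product_ring I R\<^esub> y = (\<lambda>i\<in>I. x i \<oplus>\<^bsub>R i\<^esub> y i)"
  "\<one>\<^bsub>product_ring I R\<^esub> = (\<lambda>i\<in>I. \<one>\<^bsub>R i\<^esub>)"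
  "\<zero>\<^bsub>product_ring I R\<^esub> = (\<lambda>i\<in>I. \<zero>\<^bsub>R i\<^esub>)"
  by (simp_all add: product_ring_def)

lemma ring_product_ring:
  assumes "\<And>i. i \<in> I \<Longrightarrow> ring (R i)"
  shows "ring (product_ring I R)"
  unfolding product_ring_def
proof (rule ringI)
  note closed = ring.ring_simprules(1-6)[OF assms]
  note ext = PiE_iff fun_eq_iff extensional_def
  let ?P = "\<lparr>carrier = (\<Pi>\<^sub>E i\<in>I. carrier (R i)), monoid.mult = (\<lambda>x y. \<lambda>i\<in>I. x i \<otimes>\<^bsub>R i\<^esub> y i),
     one = (\<lambda>i\<in>I. \<one>\<^bsub>R i\<^esub>), zero = (\<lambda>i\<in>I. \<zero>\<^bsub>R i\<^esub>), add = (\<lambda>x y. \<lambda>i\<in>I. x i \<oplus>\<^bsub>R i\<^esub> y i)\<rparr>"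
  show "abelian_group ?P"
  proof (rule abelian_groupI)
    fix x assume "x \<in> carrier ?P"
    then show "\<exists>y\<in>carrier ?P. y \<oplus>\<^bsub>?P\<^esub> x = \<zero>\<^bsub>?P\<^esub>"
      by (intro bexI[of _ "\<lambda>i\<in>I. \<ominus>\<^bsub>R i\<^esub> x i"])
        (auto simp: PiE_iff fun_eq_iff ring.ring_simprules(9) assms closed)
  qed (auto simp: ext closed ring.ring_simprules(7,8,10,15,22)[OF assms])
  show "Group.monoid ?P"
    by (rule monoidI)
      (auto simp: ext closed ring.ring_simprules(11,12)[OF assms]
        monoid.r_one[OF ring.is_monoid[OF assms]])
qed (auto simp: PiE_iff fun_eq_iff ring.ring_simprules(1,5,13,23)[OF assms])

text \<open>The embedding of the factor \<open>k\<close>. It respects sums and products but sends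
  the unit only to a central idempotent of the product.\<close>

definition product_single ::
    "'i set \<Rightarrow> ('i \<Rightarrow> ('a, 'b) ring_scheme) \<Rightarrow> 'i \<Rightarrow> 'a \<Rightarrow> 'i \<Rightarrow> 'a" where
  "product_single I R k y = (\<lambda>i\<in>I. if i = k then y else \<zero>\<^bsub>R i\<^esub>)"

text \<open>The factors carry arbitrary topologies, and continuity of \<open>g\<close> is part of
  the conclusion, because the lemma is used twice in a row: on the outer product, whose factors are
  themselves powers with a product topology, and then on the single power that it selects.\<close>

lemma product_ring_hom_factors:
  assumes R: "\<And>i. i \<in> I \<Longrightarrow> ring (R i)"
    and T: "\<And>i. i \<in> I \<Longrightarrow> topspace (T i) = carrier (R i)"
    and A: "simple_ring A"
    and f: "f \<in> Ring.ring_hom (product_ring I R) A"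
    and surj: "f ` carrier (product_ring I R) = carrier A"
    and cont: "continuous_map (product_topology T I) (discrete_topology (carrier A)) f"
  shows "\<exists>k\<in>I. \<exists>g\<in>Ring.ring_hom (R k) A. g ` carrier (R k) = carrier A
    \<and> continuous_map (T k) (discrete_topology (carrier A)) g
    \<and> (\<forall>x\<in>carrier (product_ring I R). f x = g (x k))"
proof -
  let ?P = "product_ring I R"
  interpret A: ring A using A by (simp add: simple_ring_def)
  interpret P: ring ?P by (rule ring_product_ring[OF R])
  interpret f: ring_hom_ring ?P A f by (rule ring_hom_ringI2) (fact P.ring_axioms A.ring_axioms f)+
  have zero [simp]: "\<zero>\<^bsub>R i\<^esub> \<in> carrier (R i)" and one [simp]: "\<one>\<^bsub>R i\<^esub> \<in> carrier (R i)" if "i \<in> I" for i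
    using R[OF that] by (auto simp: ring.ring_simprules)
  have single [simp]: "product_single I R k y \<in> carrier ?P" if "k \<in> I" "y \<in> carrier (R k)" for k y
    using that by (auto simp: product_single_def)
  have top: "topspace (product_topology T I) = carrier ?P"
    using T by (auto simp: PiE_iff)
  have "openin (product_topology T I) {x \<in> topspace (product_topology T I). f x \<in> {\<zero>\<^bsub>A\<^esub>}}"
    using cont by (rule openin_continuous_map_preimage) simp
  moreover have "\<zero>\<^bsub>?P\<^esub> \<in> {x \<in> topspace (product_topology T I). f x \<in> {\<zero>\<^bsub>A\<^esub>}}"
    unfolding top using f.hom_zero P.zero_closed by blast
  ultimately obtain U where U: "finite {i \<in> I. U i \<noteq> topspace (T i)}" "\<zero>\<^bsub>?P\<^esub> \<in> Pi\<^sub>E I U"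
    "Pi\<^sub>E I U \<subseteq> {x \<in> topspace (product_topology T I). f x \<in> {\<zero>\<^bsub>A\<^esub>}}"
    unfolding openin_product_topology_alt by meson
  \<comment> \<open>\<open>S\<close> is the finite set of coordinates that the basic neighbourhood
    restricts. The element \<open>co\<close> lies in that neighbourhood: on \<open>S\<close> it
    agrees with zero, which is there by choice of \<open>U\<close>, and off \<open>S\<close> there
    is no restriction. Thus \<open>f\<close> kills \<open>co\<close>.\<close>
  define S where "S = {i \<in> I. U i \<noteq> topspace (T i)}"
  define co where "co = (\<lambda>i\<in>I. if i \<in> S then \<zero>\<^bsub>R i\<^esub> else \<one>\<^bsub>R i\<^esub>)"
  define chi where "chi J = (\<lambda>i\<in>I. if i \<in> J then \<one>\<^bsub>R i\<^esub> else \<zero>\<^bsub>R i\<^esub>)" for J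
  have chi [simp]: "chi J \<in> carrier ?P" for J
    by (auto simp: chi_def)
  have co [simp]: "co \<in> carrier ?P"
    by (auto simp: co_def)
  have "co \<in> Pi\<^sub>E I U"
    using U(2) T by (auto simp: co_def S_def PiE_iff)
  then have f_co: "f co = \<zero>\<^bsub>A\<^esub>" using U(3) by auto
  have "\<exists>k\<in>S. f (product_single I R k \<one>\<^bsub>R k\<^esub>) \<noteq> \<zero>\<^bsub>A\<^esub>"
  proof (rule ccontr)
    assume *: "\<not> ?thesis"
    have "finite S" "S \<subseteq> I" using U(1) by (auto simp: S_def)
    \<comment> \<open>\<open>chi S\<close> is a finite sum of unit idempotents. If \<open>f\<close>
      killed each of them it would kill \<open>chi S\<close>, and hence the unit
      \<open>chi S\<close> plus \<open>co\<close>.\<close>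
    have "f (chi J) = \<zero>\<^bsub>A\<^esub>" if "finite J" "J \<subseteq> S" for J
      using that
    proof (induction J)
      case empty
      have "chi {} = \<zero>\<^bsub>?P\<^esub>" by (auto simp: chi_def)
      then show ?case using f.hom_zero by metis
    next
      case (insert k J)
      then have k: "k \<in> I" "f (product_single I R k \<one>\<^bsub>R k\<^esub>) = \<zero>\<^bsub>A\<^esub>"
        using * \<open>S \<subseteq> I\<close> by auto
      have "chi (insert k J) = product_single I R k \<one>\<^bsub>R k\<^esub> \<oplus>\<^bsub>?P\<^esub> chi J"
        using insert.hyps R by (auto simp: chi_def product_single_def fun_eq_iff ring.ring_simprules)
      then have "f (chi (insert k J)) = f (product_single I R k \<one>\<^bsub>R k\<^esub>) \<oplus>\<^bsub>A\<^esub> f (chi J)"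
        using k by (metis f.hom_add chi single one)
      then show ?case using insert k by simp
    qed
    then have "f (chi S) = \<zero>\<^bsub>A\<^esub>" using \<open>finite S\<close> by auto
    moreover have "\<one>\<^bsub>?P\<^esub> = chi S \<oplus>\<^bsub>?P\<^esub> co"
      using R by (auto simp: chi_def co_def fun_eq_iff ring.ring_simprules)
    then have "\<one>\<^bsub>A\<^esub> = f (chi S) \<oplus>\<^bsub>A\<^esub> f co"
      by (metis f.hom_add f.hom_one chi co)
    ultimately show False
      using A f_co by (simp add: simple_ring_def)
  qed
  then obtain k where k: "k \<in> I" "f (product_single I R k \<one>\<^bsub>R k\<^esub>) \<noteq> \<zero>\<^bsub>A\<^esub>"
    by (auto simp: S_def)
  interpret Rk: ring "R k" by (rule R) fact
  let ?e = "product_single I R k \<one>\<^bsub>R k\<^esub>"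
  \<comment> \<open>Multiplication by \<open>?e\<close> on either side projects to the factor
    \<open>k\<close>. This yields idempotence, centrality and, at the end, the factorisation of
    \<open>f\<close>.\<close>
  have e_mult: "?e \<otimes>\<^bsub>?P\<^esub> x = product_single I R k (x k)"
    "x \<otimes>\<^bsub>?P\<^esub> ?e = product_single I R k (x k)" if "x \<in> carrier ?P" for x
    using that R k(1) by (auto simp: product_single_def fun_eq_iff PiE_iff ring.ring_simprules)
  have e: "?e \<in> carrier ?P" using k one single by blast
  have fe: "f ?e = \<one>\<^bsub>A\<^esub>"
  proof (rule A.simple_ring_central_idempotent[OF A])
    show "f ?e \<otimes>\<^bsub>A\<^esub> f ?e = f ?e"
    proof -
      have "?e \<otimes>\<^bsub>?P\<^esub> ?e = ?e"
        using e_mult(1)[OF e] k by (simp add: product_single_def)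
      then show ?thesis by (metis f.hom_mult e)
    qed
    \<comment> \<open>Centrality survives passing to the image because \<open>f\<close> is
      onto.\<close>
    fix a assume "a \<in> carrier A"
    then obtain x where x: "x \<in> carrier ?P" "a = f x" using surj by auto
    then show "f ?e \<otimes>\<^bsub>A\<^esub> a = a \<otimes>\<^bsub>A\<^esub> f ?e"
      by (metis f.hom_mult e e_mult)
  qed (use k e f.hom_closed in blast)+
  \<comment> \<open>The restriction of \<open>f\<close> to the factor \<open>k\<close>. It preserves
    the unit exactly because \<open>f\<close> sends \<open>?e\<close> to the unit, and multiplying
    \<open>f x\<close> by that unit shows that only \<open>x k\<close> matters.\<close>
  define g where "g = (\<lambda>y. f (product_single I R k y))"
  show ?thesis
  proof (intro bexI[of _ k] bexI[of _ g] conjI ballI)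
    show eq: "f x = g (x k)" if "x \<in> carrier ?P" for x
    proof -
      have "f x = f x \<otimes>\<^bsub>A\<^esub> f ?e" using fe f.hom_closed[OF that] by simp
      also have "\<dots> = f (x \<otimes>\<^bsub>?P\<^esub> ?e)" using that e by (simp only: f.hom_mult)
      finally show ?thesis using that by (simp only: e_mult g_def)
    qed
    show "g \<in> Ring.ring_hom (R k) A"
    proof (rule ring_hom_memI)
      fix x y assume xy: "x \<in> carrier (R k)" "y \<in> carrier (R k)"
      show "g x \<in> carrier A"
        unfolding g_def using xy k by (intro f.hom_closed single)
      have "product_single I R k (x \<otimes>\<^bsub>R k\<^esub> y) = product_single I R k x \<otimes>\<^bsub>?P\<^esub> product_single I R k y"
        using R by (auto simp: product_single_def fun_eq_iff ring.ring_simprules)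
      then show "g (x \<otimes>\<^bsub>R k\<^esub> y) = g x \<otimes>\<^bsub>A\<^esub> g y"
        unfolding g_def using xy k by (metis f.hom_mult single)
      have "product_single I R k (x \<oplus>\<^bsub>R k\<^esub> y) = product_single I R k x \<oplus>\<^bsub>?P\<^esub> product_single I R k y"
        using R by (auto simp: product_single_def fun_eq_iff ring.ring_simprules)
      then show "g (x \<oplus>\<^bsub>R k\<^esub> y) = g x \<oplus>\<^bsub>A\<^esub> g y"
        unfolding g_def using xy k by (metis f.hom_add single)
    next
      show "g \<one>\<^bsub>R k\<^esub> = \<one>\<^bsub>A\<^esub>" using fe by (simp add: g_def)
    qed
    show "g ` carrier (R k) = carrier A"
    proof
      show "g ` carrier (R k) \<subseteq> carrier A"
        unfolding g_def using k f.hom_closed single by blast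
      show "carrier A \<subseteq> g ` carrier (R k)"
        unfolding surj[symmetric] using eq k(1) by (auto simp: PiE_iff)
    qed
    have "continuous_map (T k) (product_topology T I) (product_single I R k)"
      unfolding continuous_map_componentwise
    proof (intro conjI ballI)
      show "product_single I R k ` topspace (T k) \<subseteq> extensional I"
        by (auto simp: product_single_def)
      fix i assume "i \<in> I"
      then show "continuous_map (T k) (T i) (\<lambda>x. product_single I R k x i)"
        by (cases "i = k") (auto simp: product_single_def T)
    qed
    then show "continuous_map (T k) (discrete_topology (carrier A)) g"
      unfolding g_def using cont by (rule continuous_map_compose[unfolded comp_def])
  qed (fact k(1))
qed

section \<open>Groups of automorphisms\<close>

lemma subgroup_ring_autos:
  assumes "ring R"
  shows "subgroup (ring_autos R) (BijGroup (carrier R))"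
proof (rule group.subgroupI[OF group_BijGroup])
  interpret ring R by fact
  show "ring_autos R \<subseteq> carrier (BijGroup (carrier R))"
    by (auto simp: ring_autos_def BijGroup_def)
  have "(\<lambda>x\<in>carrier R. x) \<in> ring_autos R"
    by (auto simp: ring_autos_def id_Bij intro!: ring_hom_memI)
  then show "ring_autos R \<noteq> {}" by blast
  fix f assume f: "f \<in> ring_autos R"
  then have B: "f \<in> Bij (carrier R)" and hom: "f \<in> Ring.ring_hom R R"
    by (auto simp: ring_autos_def)
  have "(\<lambda>x\<in>carrier R. inv_into (carrier R) f x) \<in> Ring.ring_hom R R"
  proof (rule ring_hom_memI)
    have inj: "inj_on f (carrier R)" using B by (auto simp: Bij_def bij_betw_def)
    show "(\<lambda>x\<in>carrier R. inv_into (carrier R) f x) \<one>\<^bsub>R\<^esub> = \<one>\<^bsub>R\<^esub>"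
      using inj hom inv_into_f_f[OF inj one_closed] by (simp add: ring_hom_one)
  qed (use B hom in \<open>auto simp: Bij_inv_into_mem ring_hom_mult ring_hom_add
        intro!: Bij_inv_into_lemma\<close>)
  then show "inv\<^bsub>BijGroup (carrier R)\<^esub> f \<in> ring_autos R"
    using B by (simp add: inv_BijGroup ring_autos_def restrict_inv_into_Bij)
  fix g assume g: "g \<in> ring_autos R"
  have "compose (carrier R) f g \<in> Ring.ring_hom R R"
    using f g unfolding ring_autos_def
    by (intro ring_hom_memI)
      (auto simp: compose_def ring_hom_closed ring_hom_mult ring_hom_add ring_hom_one)
  then show "f \<otimes>\<^bsub>BijGroup (carrier R)\<^esub> g \<in> ring_autos R"
    using f g by (auto simp: ring_autos_def BijGroup_def compose_Bij)
qed

lemma subgroup_topological_ring_autos: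
  assumes "ring R" and T: "topspace T = carrier R"
  shows "subgroup (topological_ring_autos R T) (BijGroup (carrier R))"
proof (rule group.subgroupI[OF group_BijGroup])
  interpret A: subgroup "ring_autos R" "BijGroup (carrier R)"
    using assms(1) by (rule subgroup_ring_autos)
  show "topological_ring_autos R T \<subseteq> carrier (BijGroup (carrier R))"
    using A.subset by (auto simp: topological_ring_autos_def)
  have "homeomorphic_map T T (\<lambda>x\<in>carrier R. x)"
    using homeomorphic_map_eq[of T T id] by (simp add: T)
  moreover have "(\<lambda>x\<in>carrier R. x) \<in> ring_autos R"
    using A.one_closed by (simp add: BijGroup_def)
  ultimately show "topological_ring_autos R T \<noteq> {}"
    unfolding topological_ring_autos_def by blast
  fix f assume f: "f \<in> topological_ring_autos R T"
  then have B: "f \<in> Bij (carrier R)" and fA: "f \<in> ring_autos R" and "homeomorphic_map T T f"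
    by (auto simp: topological_ring_autos_def ring_autos_def)
  then obtain g where g: "homeomorphic_maps T T f g"
    using homeomorphic_map_maps by blast
  have inj: "inj_on f (carrier R)" using B by (simp add: Bij_def bij_betw_def)
  \<comment> \<open>The continuous inverse \<open>g\<close> is arbitrary outside the carrier,
    whereas the inverse in \<open>BijGroup\<close> is extensional; they have to be compared on the
    carrier.\<close>
  have "inv_into (carrier R) f y = g y" if "y \<in> carrier R" for y
  proof (rule inv_into_f_eq[OF inj])
    show "g y \<in> carrier R" "f (g y) = y"
      using that g continuous_map_image_subset_topspace[of T T g]
      unfolding homeomorphic_maps_def T by blast+
  qed
  moreover have "homeomorphic_map T T g"
    using g homeomorphic_map_maps homeomorphic_maps_sym by blast
  ultimately have "homeomorphic_map T T (\<lambda>x\<in>carrier R. inv_into (carrier R) f x)"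
    using homeomorphic_map_eq[of T T g] by (simp add: T)
  then show "inv\<^bsub>BijGroup (carrier R)\<^esub> f \<in> topological_ring_autos R T"
    using A.m_inv_closed[OF fA] B by (simp add: topological_ring_autos_def inv_BijGroup)
  fix g assume g: "g \<in> topological_ring_autos R T"
  have "homeomorphic_map T T (compose (carrier R) f g)"
    by (rule homeomorphic_map_eq[OF homeomorphic_map_compose[of T T g T f]])
      (use f g in \<open>auto simp: topological_ring_autos_def T compose_def\<close>)
  then show "f \<otimes>\<^bsub>BijGroup (carrier R)\<^esub> g \<in> topological_ring_autos R T"
    using f g A.m_closed[of f g] by (auto simp: topological_ring_autos_def ring_autos_def BijGroup_def)
qed

lemma group_ring_auto_group: "ring R \<Longrightarrow> group (ring_auto_group R)"
  unfolding ring_auto_group_def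
  by (intro subgroup.subgroup_is_group subgroup_ring_autos group_BijGroup)

text \<open>Each \<open>\<phi> g\<close> is a slice of the jointly continuous action, and the slice
  at the inverse of \<open>g\<close> inverts it, so it is a homeomorphism. The image of the
  homomorphism \<open>\<phi>\<close> is a subgroup of all bijections that lies in the topological
  automorphisms.\<close>

lemma (in compact_G_ring) subgroup_image_topological_ring_autos:
  "subgroup (\<phi> ` carrier G) (topological_ring_auto_group R T)"
proof -
  have G: "group G" using group_hom by (rule group_hom.axioms)
  interpret \<phi>: group_hom G "BijGroup (carrier R)" \<phi> by (rule group_hom)
  have cont: "continuous_map T T (\<phi> g)" if "g \<in> carrier G" for g
  proof -
    have "continuous_map T (prod_topology S T) (\<lambda>x. (g, x))"
      using that by (intro continuous_map_pairedI) (auto simp: topspace_group)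
    from continuous_map_compose[OF this continuous_action] show ?thesis
      by (simp add: comp_def)
  qed
  have "\<phi> g \<in> topological_ring_autos R T" if g: "g \<in> carrier G" for g
  proof -
    have inverse: "\<phi> (inv\<^bsub>G\<^esub> h) (\<phi> h x) = x" if "h \<in> carrier G" "x \<in> carrier R" for h x
      using that orbit_sym_aux by blast
    have "homeomorphic_maps T T (\<phi> g) (\<phi> (inv\<^bsub>G\<^esub> g))"
      unfolding homeomorphic_maps_def topspace_ring
      using g cont inverse by (metis group.inv_closed[OF G] group.inv_inv[OF G])
    then show ?thesis
      using acts_by_ring_autos[OF g] homeomorphic_map_maps
      by (auto simp: topological_ring_autos_def)
  qed
  then show ?thesis
    unfolding topological_ring_auto_group_def
    by (intro group.subgroup_incl[OF \<phi>.H.group_axioms] \<phi>.img_is_subgroup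
        subgroup_topological_ring_autos ring_axioms topspace_ring) blast
qed

text \<open>Inversion reverses the order of composition, and so does precomposition; together they
  make \<open>coord_perm\<close> a left action.\<close>

lemma inv_into_compose_Bij:
  assumes "\<sigma> \<in> Bij K" "\<tau> \<in> Bij K" "\<alpha> \<in> K"
  shows "inv_into K (compose K \<sigma> \<tau>) \<alpha> = inv_into K \<tau> (inv_into K \<sigma> \<alpha>)"
proof (rule inv_into_f_eq)
  show "inj_on (compose K \<sigma> \<tau>) K"
    using compose_Bij[OF assms(1,2)] by (simp add: Bij_def bij_betw_def)
  have "inv_into K \<sigma> \<alpha> \<in> K" "\<sigma> ` K = K" "\<tau> ` K = K"
    using assms by (auto simp: Bij_inv_into_mem) (auto simp: Bij_def bij_betw_def)
  then show "inv_into K \<tau> (inv_into K \<sigma> \<alpha>) \<in> K"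
    "compose K \<sigma> \<tau> (inv_into K \<tau> (inv_into K \<sigma> \<alpha>)) = \<alpha>"
    using assms by (simp_all add: Bij_inv_into_mem compose_def f_inv_into_f)
qed

lemma inv_into_restrict_id: "\<alpha> \<in> K \<Longrightarrow> inv_into K (\<lambda>x\<in>K. x) \<alpha> = \<alpha>"
  by (rule inv_into_f_eq) (auto simp: inj_on_def)

text \<open>The direction is reversed because \<open>act\<close> starts at the semidirect product,
  while the theorem asks for an isomorphism onto it. Inverting the map takes only closure of
  \<open>G\<close> under its multiplication, so the group axioms for the semidirect product are
  never checked separately.\<close>

lemma iso_of_bij_hom:
  assumes f: "f \<in> hom G H" "bij_betw f (carrier G) (carrier H)"
    and closed: "\<And>x y. x \<in> carrier G \<Longrightarrow> y \<in> carrier G \<Longrightarrow> x \<otimes>\<^bsub>G\<^esub> y \<in> carrier G"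
  shows "H \<cong> G"
proof -
  have inj: "inj_on f (carrier G)" and surj: "f ` carrier G = carrier H"
    using f(2) by (auto simp: bij_betw_def)
  have "inv_into (carrier G) f \<in> hom H G"
  proof (rule homI)
    fix x y assume "x \<in> carrier H" "y \<in> carrier H"
    then obtain a b where "a \<in> carrier G" "b \<in> carrier G" "x = f a" "y = f b"
      unfolding surj[symmetric] by blast
    then show "inv_into (carrier G) f (x \<otimes>\<^bsub>H\<^esub> y)
        = inv_into (carrier G) f x \<otimes>\<^bsub>G\<^esub> inv_into (carrier G) f y"
      using inj closed f(1) by (simp add: inv_into_f_f flip: hom_mult)
  qed (use surj in \<open>simp add: inv_into_into\<close>)
  then show ?thesis
    using bij_betw_inv_into[OF f(2)] by (auto simp: is_iso_def iso_def)
qed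

section \<open>Automorphisms of products of powers of simple rings\<close>

text \<open>Keeps matrix entries out of the argument: the factors enter only as simple rings of
  pairwise distinct isomorphism types.\<close>

locale simple_ring_powers =
  fixes m :: nat and M :: "nat \<Rightarrow> ('x, 'c) ring_scheme" and K :: "nat \<Rightarrow> 'k set"
  assumes simple: "i \<in> {1..m} \<Longrightarrow> simple_ring (M i)"
    and distinct: "i \<in> {1..m} \<Longrightarrow> j \<in> {1..m} \<Longrightarrow> i \<noteq> j \<Longrightarrow> \<not> M i \<simeq> M j"
begin

text \<open>Prevents the simplifier from turning \<open>{1..m}\<close> into
  \<open>{Suc 0..m}\<close>, which would no longer match the hypotheses.\<close>

declare One_nat_def [simp del]

abbreviation P where
  "P \<equiv> product_ring {1..m} (\<lambda>i. product_ring (K i) (\<lambda>_. M i))"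

abbreviation T where
  "T \<equiv> product_topology
     (\<lambda>i. product_topology (\<lambda>_. discrete_topology (carrier (M i))) (K i)) {1..m}"

abbreviation A where
  "A \<equiv> product_group {1..m} (\<lambda>i. product_group (K i) (\<lambda>_. ring_auto_group (M i)))"

abbreviation S where
  "S \<equiv> Sym_product m K"

text \<open>The automorphism is applied after the permutation, opposite to
  \<^const>\<open>permuted_coordwise_autos\<close>: in this order \<open>act\<close> is multiplicative for the multiplication
  of \<^const>\<open>semidirect_product\<close>.\<close>

definition act :: "(nat \<Rightarrow> 'k \<Rightarrow> 'x \<Rightarrow> 'x) \<times> (nat \<Rightarrow> 'k \<Rightarrow> 'k) \<Rightarrow> (nat \<Rightarrow> 'k \<Rightarrow> 'x) \<Rightarrow> nat \<Rightarrow> 'k \<Rightarrow> 'x"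
  where "act = (\<lambda>(a, \<sigma>). \<lambda>x\<in>carrier P. coordwise m K a (coord_perms m K \<sigma> x))"

section \<open>Carriers of the product ring and of the two factor groups\<close>

lemma ring_M: "i \<in> {1..m} \<Longrightarrow> ring (M i)"
  using simple by (simp add: simple_ring_def)

lemma one_not_zero_M: "i \<in> {1..m} \<Longrightarrow> \<one>\<^bsub>M i\<^esub> \<noteq> \<zero>\<^bsub>M i\<^esub>"
  using simple by (simp add: simple_ring_def)

lemma ring_K: "i \<in> {1..m} \<Longrightarrow> ring (product_ring (K i) (\<lambda>_. M i))"
  by (intro ring_product_ring ring_M)

lemma ring_P: "ring P"
  by (intro ring_product_ring ring_M)

lemma topspace_T: "topspace T = carrier P"
  by simp

lemma carrier_PE:
  assumes "x \<in> carrier P" "i \<in> {1..m}" "\<alpha> \<in> K i"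
  shows "x i \<alpha> \<in> carrier (M i)"
  using assms by (auto simp: PiE_iff)

lemma carrier_P_eqI:
  assumes "x \<in> carrier P" "y \<in> carrier P"
    and "\<And>i \<alpha>. i \<in> {1..m} \<Longrightarrow> \<alpha> \<in> K i \<Longrightarrow> x i \<alpha> = y i \<alpha>"
  shows "x = y"
proof -
  have "x i = y i" if "i \<in> {1..m}" for i
    using assms that by (intro extensionalityI[of _ "K i"]) (auto simp: PiE_iff)
  then show ?thesis
    using assms by (intro extensionalityI[of _ "{1..m}"]) (auto simp: PiE_iff)
qed

lemma carrier_AE:
  assumes "a \<in> carrier A" "i \<in> {1..m}" "\<alpha> \<in> K i"
  shows "a i \<alpha> \<in> Ring.ring_hom (M i) (M i)" "a i \<alpha> \<in> Bij (carrier (M i))"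
proof -
  have "a i \<alpha> \<in> ring_autos (M i)"
    using assms by (auto simp: PiE_iff ring_auto_group_def)
  then show "a i \<alpha> \<in> Ring.ring_hom (M i) (M i)" "a i \<alpha> \<in> Bij (carrier (M i))"
    by (auto simp: ring_autos_def)
qed

lemma carrier_AE_closed:
  "a \<in> carrier A \<Longrightarrow> i \<in> {1..m} \<Longrightarrow> \<alpha> \<in> K i \<Longrightarrow> y \<in> carrier (M i) \<Longrightarrow> a i \<alpha> y \<in> carrier (M i)"
  by (rule ring_hom_closed[OF carrier_AE(1)])

lemma carrier_S: "\<sigma> \<in> carrier S \<longleftrightarrow> \<sigma> \<in> (\<Pi>\<^sub>E i\<in>{1..m}. Bij (K i))"
  by (simp add: Sym_product_def BijGroup_def)

lemma carrier_SE: "\<sigma> \<in> carrier S \<Longrightarrow> i \<in> {1..m} \<Longrightarrow> \<sigma> i \<in> Bij (K i)"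
  by (auto simp: carrier_S)

lemma group_A: "group A"
  by (intro product_group group_ring_auto_group ring_M)

lemma group_S: "group S"
  unfolding Sym_product_def by (intro product_group group_BijGroup)

section \<open>Permutations and coordinatewise automorphisms as two actions\<close>

lemma coord_perms_index [simp]:
  "i \<in> {1..m} \<Longrightarrow> \<alpha> \<in> K i \<Longrightarrow> coord_perms m K \<sigma> x i \<alpha> = x i (inv_into (K i) (\<sigma> i) \<alpha>)"
  by (simp add: coord_perms_def coord_perm_def)

lemma coordwise_index [simp]:
  "i \<in> {1..m} \<Longrightarrow> \<alpha> \<in> K i \<Longrightarrow> coordwise m K a x i \<alpha> = a i \<alpha> (x i \<alpha>)"
  by (simp add: coordwise_def)

text \<open>Generic in \<open>X\<close> since it serves ring elements and families of automorphisms
  alike. The sets may depend on \<open>i\<close> but not on \<alpha>, as coordinates move only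
  within one type.\<close>

lemma coord_perms_closed:
  assumes "\<sigma> \<in> carrier S" "x \<in> (\<Pi>\<^sub>E i\<in>{1..m}. \<Pi>\<^sub>E \<alpha>\<in>K i. X i)"
  shows "coord_perms m K \<sigma> x \<in> (\<Pi>\<^sub>E i\<in>{1..m}. \<Pi>\<^sub>E \<alpha>\<in>K i. X i)"
  using assms Bij_inv_into_mem[OF carrier_SE[OF assms(1)]]
  by (auto simp: coord_perms_def coord_perm_def PiE_iff)

lemma coord_perms_P:
  "\<sigma> \<in> carrier S \<Longrightarrow> x \<in> carrier P \<Longrightarrow> coord_perms m K \<sigma> x \<in> carrier P"
  using coord_perms_closed[of \<sigma> x "\<lambda>i. carrier (M i)"] by simp

lemma coord_perms_A:
  "\<sigma> \<in> carrier S \<Longrightarrow> a \<in> carrier A \<Longrightarrow> coord_perms m K \<sigma> a \<in> carrier A"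
  using coord_perms_closed[of \<sigma> a "\<lambda>i. carrier (ring_auto_group (M i))"] by simp

lemma coordwise_P:
  assumes "a \<in> carrier A" "x \<in> carrier P"
  shows "coordwise m K a x \<in> carrier P"
  using carrier_AE_closed[OF assms(1)] carrier_PE[OF assms(2)]
  by (auto simp: coordwise_def)

lemma mult_S:
  assumes "\<sigma> \<in> carrier S" "\<tau> \<in> carrier S" "i \<in> {1..m}"
  shows "(\<sigma> \<otimes>\<^bsub>S\<^esub> \<tau>) i = compose (K i) (\<sigma> i) (\<tau> i)"
  using carrier_SE[OF assms(1,3)] carrier_SE[OF assms(2,3)] assms(3)
  by (simp add: Sym_product_def BijGroup_def)

lemma mult_A:
  assumes "a \<in> carrier A" "b \<in> carrier A" "i \<in> {1..m}" "\<alpha> \<in> K i"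
  shows "(a \<otimes>\<^bsub>A\<^esub> b) i \<alpha> = compose (carrier (M i)) (a i \<alpha>) (b i \<alpha>)"
  using carrier_AE(2)[OF assms(1,3,4)] carrier_AE(2)[OF assms(2,3,4)] assms(3,4)
  by (simp add: ring_auto_group_def BijGroup_def)

lemma inv_into_closed:
  "\<sigma> \<in> carrier S \<Longrightarrow> i \<in> {1..m} \<Longrightarrow> \<alpha> \<in> K i \<Longrightarrow> inv_into (K i) (\<sigma> i) \<alpha> \<in> K i"
  by (intro Bij_inv_into_mem carrier_SE)

lemma coord_perms_mult:
  assumes "\<sigma> \<in> carrier S" "\<tau> \<in> carrier S"
  shows "coord_perms m K (\<sigma> \<otimes>\<^bsub>S\<^esub> \<tau>) x = coord_perms m K \<sigma> (coord_perms m K \<tau> x)"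
proof -
  have "coord_perm (K i) ((\<sigma> \<otimes>\<^bsub>S\<^esub> \<tau>) i) (x i) = coord_perm (K i) (\<sigma> i) (coord_perm (K i) (\<tau> i) (x i))"
    if "i \<in> {1..m}" for i
    using assms that inv_into_closed[OF assms(1) that]
      inv_into_compose_Bij[OF carrier_SE[OF assms(1) that] carrier_SE[OF assms(2) that]]
    unfolding mult_S[OF assms that] by (auto simp: coord_perm_def)
  then show ?thesis
    unfolding coord_perms_def by (intro restrict_ext) simp
qed

lemma coord_perms_one:
  assumes "x \<in> (\<Pi>\<^sub>E i\<in>{1..m}. \<Pi>\<^sub>E \<alpha>\<in>K i. X i)"
  shows "coord_perms m K \<one>\<^bsub>S\<^esub> x = x"
proof (rule extensionalityI[of _ "{1..m}"])
  fix i assume i: "i \<in> {1..m}"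
  show "coord_perms m K \<one>\<^bsub>S\<^esub> x i = x i"
  proof (rule extensionalityI[of _ "K i"])
    show "coord_perms m K \<one>\<^bsub>S\<^esub> x i \<in> extensional (K i)" "x i \<in> extensional (K i)"
      using assms i by (auto simp: coord_perms_def coord_perm_def PiE_iff)
    show "coord_perms m K \<one>\<^bsub>S\<^esub> x i \<alpha> = x i \<alpha>" if "\<alpha> \<in> K i" for \<alpha>
      using i that inv_into_restrict_id[OF that] by (simp add: Sym_product_def BijGroup_def)
  qed
qed (use assms in \<open>auto simp: coord_perms_def PiE_iff\<close>)

lemma coordwise_mult:
  assumes "a \<in> carrier A" "b \<in> carrier A" "x \<in> carrier P"
  shows "coordwise m K (a \<otimes>\<^bsub>A\<^esub> b) x = coordwise m K a (coordwise m K b x)"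
proof (rule carrier_P_eqI)
  show "coordwise m K (a \<otimes>\<^bsub>A\<^esub> b) x \<in> carrier P"
    using assms by (intro coordwise_P monoid.m_closed[OF group.is_monoid[OF group_A]])
  show "coordwise m K a (coordwise m K b x) \<in> carrier P"
    using assms by (intro coordwise_P)
  show "coordwise m K (a \<otimes>\<^bsub>A\<^esub> b) x i \<alpha> = coordwise m K a (coordwise m K b x) i \<alpha>"
    if "i \<in> {1..m}" "\<alpha> \<in> K i" for i \<alpha>
    using that carrier_PE[OF assms(3) that] mult_A[OF assms(1,2) that]
    by (simp only: coordwise_index) (simp add: compose_def)
qed

lemma coordwise_one:
  assumes "x \<in> carrier P"
  shows "coordwise m K \<one>\<^bsub>A\<^esub> x = x"
proof (rule carrier_P_eqI)
  show "coordwise m K \<one>\<^bsub>A\<^esub> x \<in> carrier P"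
    using assms by (intro coordwise_P monoid.one_closed[OF group.is_monoid[OF group_A]])
  show "coordwise m K \<one>\<^bsub>A\<^esub> x i \<alpha> = x i \<alpha>" if "i \<in> {1..m}" "\<alpha> \<in> K i" for i \<alpha>
    using that carrier_PE[OF assms that] by (simp add: ring_auto_group_def BijGroup_def)
qed fact

text \<open>The commutation rule behind everything that follows: conjugating a coordinatewise
  automorphism by a permutation permutes its components. It explains the twist in the semidirect
  product and lets the two orders of composition be exchanged.\<close>

lemma coord_perms_coordwise:
  assumes "\<sigma> \<in> carrier S" "a \<in> carrier A" "x \<in> carrier P"
  shows "coord_perms m K \<sigma> (coordwise m K a x)
    = coordwise m K (coord_perms m K \<sigma> a) (coord_perms m K \<sigma> x)"
proof (rule carrier_P_eqI)
  show "coord_perms m K \<sigma> (coordwise m K a x) i \<alpha>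
      = coordwise m K (coord_perms m K \<sigma> a) (coord_perms m K \<sigma> x) i \<alpha>"
    if "i \<in> {1..m}" "\<alpha> \<in> K i" for i \<alpha>
    using that inv_into_closed[OF assms(1) that] by simp
qed (intro coord_perms_P coordwise_P coord_perms_A assms)+

section \<open>The semidirect product acting by topological automorphisms\<close>

abbreviation N where "N \<equiv> semidirect_product A S (coord_perms m K)"

lemma carrier_N: "p \<in> carrier N \<longleftrightarrow> fst p \<in> carrier A \<and> snd p \<in> carrier S"
  by (cases p) (simp add: semidirect_product_def del: carrier_product_group)

lemma N_closed: "p \<in> carrier N \<Longrightarrow> q \<in> carrier N \<Longrightarrow> p \<otimes>\<^bsub>N\<^esub> q \<in> carrier N"
  using group.is_monoid[OF group_A] group.is_monoid[OF group_S]
  by (auto simp: semidirect_product_def coord_perms_A monoid.m_closed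
      simp del: carrier_product_group mult_product_group)

lemma act_apply: "x \<in> carrier P \<Longrightarrow> act p x = coordwise m K (fst p) (coord_perms m K (snd p) x)"
  by (simp add: act_def case_prod_unfold)

lemma act_closed: "p \<in> carrier N \<Longrightarrow> x \<in> carrier P \<Longrightarrow> act p x \<in> carrier P"
  by (simp only: act_apply carrier_N coordwise_P coord_perms_P)

text \<open>Moving \<sigma> past \<open>b\<close> with \<open>coord_perms_coordwise\<close> produces
  the twisted family that the multiplication of \<open>N\<close> prescribes.\<close>

lemma act_mult:
  assumes "p \<in> carrier N" "q \<in> carrier N" "x \<in> carrier P"
  shows "act (p \<otimes>\<^bsub>N\<^esub> q) x = act p (act q x)"
proof -
  obtain a \<sigma> b \<tau> where [simp]: "p = (a, \<sigma>)" "q = (b, \<tau>)" by (metis surj_pair)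
  have in_carrier: "a \<in> carrier A" "b \<in> carrier A" "\<sigma> \<in> carrier S" "\<tau> \<in> carrier S"
    using assms by (auto simp only: carrier_N \<open>p = _\<close> \<open>q = _\<close> fst_conv snd_conv)
  have "act p (act q x)
      = coordwise m K a (coord_perms m K \<sigma> (coordwise m K b (coord_perms m K \<tau> x)))"
    using assms act_closed[OF assms(2,3)] by (simp only: act_apply) simp
  also have "\<dots> = coordwise m K a (coordwise m K (coord_perms m K \<sigma> b)
      (coord_perms m K \<sigma> (coord_perms m K \<tau> x)))"
    using in_carrier assms(3) by (simp only: coord_perms_coordwise coord_perms_P)
  also have "\<dots> = coordwise m K (a \<otimes>\<^bsub>A\<^esub> coord_perms m K \<sigma> b) (coord_perms m K (\<sigma> \<otimes>\<^bsub>S\<^esub> \<tau>) x)"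
    using in_carrier assms(3)
    by (simp only: coordwise_mult coord_perms_mult coord_perms_P coord_perms_A)
  also have "\<dots> = act (p \<otimes>\<^bsub>N\<^esub> q) x"
    using assms(3) by (simp only: act_apply) (simp add: semidirect_product_def)
  finally show ?thesis ..
qed

lemma act_right_inverse:
  assumes "p \<in> carrier N"
  shows "\<exists>q\<in>carrier N. \<forall>x\<in>carrier P. act p (act q x) = x"
proof -
  interpret A: group A by (rule group_A)
  interpret S: group S by (rule group_S)
  obtain a \<sigma> where p: "p = (a, \<sigma>)" by (metis surj_pair)
  have a: "a \<in> carrier A" and \<sigma>: "\<sigma> \<in> carrier S"
    using assms by (simp_all only: carrier_N p fst_conv snd_conv)
  \<comment> \<open>The usual inverse of \<open>(a, \<sigma>)\<close> in a semidirect product: the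
    inverse of \<open>a\<close>, twisted by the inverse of \<sigma>. Twisting once more by \<sigma>
    cancels.\<close>
  let ?b = "coord_perms m K (inv\<^bsub>S\<^esub> \<sigma>) (inv\<^bsub>A\<^esub> a)"
  have q: "(?b, inv\<^bsub>S\<^esub> \<sigma>) \<in> carrier N"
    using a \<sigma> by (simp only: carrier_N fst_conv snd_conv coord_perms_A A.inv_closed S.inv_closed)
  have A_ext: "inv\<^bsub>A\<^esub> a \<in> (\<Pi>\<^sub>E i\<in>{1..m}. \<Pi>\<^sub>E \<alpha>\<in>K i. carrier (ring_auto_group (M i)))"
    using A.inv_closed[OF a] by (simp only: carrier_product_group)
  have "coord_perms m K \<sigma> ?b = coord_perms m K (\<sigma> \<otimes>\<^bsub>S\<^esub> inv\<^bsub>S\<^esub> \<sigma>) (inv\<^bsub>A\<^esub> a)"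
    using \<sigma> by (simp only: coord_perms_mult S.inv_closed)
  also have "\<dots> = inv\<^bsub>A\<^esub> a"
    using \<sigma> coord_perms_one[OF A_ext] by (simp only: S.r_inv)
  finally have b: "coord_perms m K \<sigma> ?b = inv\<^bsub>A\<^esub> a" .
  have pq: "p \<otimes>\<^bsub>N\<^esub> (?b, inv\<^bsub>S\<^esub> \<sigma>) = (\<one>\<^bsub>A\<^esub>, \<one>\<^bsub>S\<^esub>)"
    using a \<sigma> by (simp only: p semidirect_product_def monoid.simps prod.case b A.r_inv S.r_inv)
  have "act p (act (?b, inv\<^bsub>S\<^esub> \<sigma>) x) = x" if x: "x \<in> carrier P" for x
  proof -
    have "coord_perms m K \<one>\<^bsub>S\<^esub> x = x"
      using x by (intro coord_perms_one[of _ "\<lambda>i. carrier (M i)"]) simp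
    then show ?thesis
      using act_mult[OF assms q x] x
      by (simp only: pq act_apply fst_conv snd_conv coordwise_one)
  qed
  then show ?thesis using q by blast
qed

text \<open>Right inverses for all elements suffice, as in a monoid: if \<open>q\<close> is right
  inverse to \<open>p\<close> and \<open>r\<close> to \<open>q\<close>, then \<open>p\<close> and
  \<open>r\<close> act alike, so \<open>q\<close> is also left inverse to \<open>p\<close>.\<close>

lemma act_inverse:
  assumes "p \<in> carrier N"
  shows "\<exists>q\<in>carrier N. \<forall>x\<in>carrier P. act p (act q x) = x \<and> act q (act p x) = x"
proof -
  obtain q where q: "q \<in> carrier N" "\<forall>x\<in>carrier P. act p (act q x) = x"
    using act_right_inverse[OF assms] by blast
  obtain r where r: "r \<in> carrier N" "\<forall>x\<in>carrier P. act q (act r x) = x"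
    using act_right_inverse[OF q(1)] by blast
  have "act q (act p x) = x" if "x \<in> carrier P" for x
  proof -
    have "act p (act q (act r x)) = act r x"
      using q(2) act_closed[OF r(1) that] by (rule bspec)
    then have "act p x = act r x"
      using bspec[OF r(2) that] by (simp only:)
    then show ?thesis
      using bspec[OF r(2) that] by (simp only:)
  qed
  then show ?thesis using q by blast
qed

text \<open>Each coordinate of the value depends on one coordinate of the argument, through a map
  between discrete spaces.\<close>

lemma continuous_map_act:
  assumes "p \<in> carrier N"
  shows "continuous_map T T (act p)"
proof -
  obtain a \<sigma> where p: "p = (a, \<sigma>)" by (metis surj_pair)
  have a: "a \<in> carrier A" and \<sigma>: "\<sigma> \<in> carrier S"
    using assms by (simp_all only: carrier_N p fst_conv snd_conv)
  have closed: "act p x \<in> carrier P" if "x \<in> topspace T" for x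
    using act_closed[OF assms] that by (simp only: topspace_T)
  have coord: "continuous_map T (discrete_topology (carrier (M i))) (\<lambda>x. act p x i \<alpha>)"
    if i: "i \<in> {1..m}" and \<alpha>: "\<alpha> \<in> K i" for i \<alpha>
  proof -
    let ?\<beta> = "inv_into (K i) (\<sigma> i) \<alpha>"
    have \<beta>: "?\<beta> \<in> K i" by (intro inv_into_closed i \<alpha> \<sigma>)
    let ?Q = "\<lambda>i. product_topology (\<lambda>_. discrete_topology (carrier (M i))) (K i)"
    have "continuous_map T (?Q i) (\<lambda>x. x i)"
      by (rule continuous_map_product_coordinates[OF i])
    moreover have "continuous_map (?Q i) (discrete_topology (carrier (M i))) (\<lambda>y. y ?\<beta>)"
      by (rule continuous_map_product_coordinates[OF \<beta>])
    ultimately have "continuous_map T (discrete_topology (carrier (M i))) (\<lambda>x. x i ?\<beta>)"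
      by (rule continuous_map_compose[unfolded comp_def])
    moreover have "continuous_map (discrete_topology (carrier (M i)))
        (discrete_topology (carrier (M i))) (a i \<alpha>)"
      using carrier_AE_closed[OF a i \<alpha>] by auto
    ultimately have "continuous_map T (discrete_topology (carrier (M i))) (\<lambda>x. a i \<alpha> (x i ?\<beta>))"
      by (rule continuous_map_compose[unfolded comp_def])
    then show ?thesis
    proof (rule continuous_map_eq)
      fix x assume "x \<in> topspace T"
      then have "x \<in> carrier P" by (simp only: topspace_T)
      then show "a i \<alpha> (x i ?\<beta>) = act p x i \<alpha>"
        using i \<alpha> by (simp only: act_apply p fst_conv snd_conv coordwise_index coord_perms_index)
    qed
  qed
  have "continuous_map T (product_topology (\<lambda>_. discrete_topology (carrier (M i))) (K i))
      (\<lambda>x. act p x i)" if i: "i \<in> {1..m}" for i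
    unfolding continuous_map_componentwise
  proof (intro conjI ballI image_subsetI coord[OF i])
    show "act p x i \<in> extensional (K i)" if "x \<in> topspace T" for x
      using closed[OF that] i by (auto simp: PiE_iff)
  qed
  moreover have "act p x \<in> extensional {1..m}" if "x \<in> topspace T" for x
    using closed[OF that] by (auto simp: PiE_iff)
  ultimately show ?thesis
    by (subst continuous_map_componentwise) (intro conjI ballI image_subsetI)
qed

text \<open>The inverse map is again of the form \<open>act q\<close>, so
  \<open>continuous_map_act\<close> covers both directions of the homeomorphism.\<close>

lemma act_in_topological_ring_autos:
  assumes "p \<in> carrier N"
  shows "act p \<in> topological_ring_autos P T"
proof -
  obtain q where q: "q \<in> carrier N"
    "\<forall>x\<in>carrier P. act p (act q x) = x \<and> act q (act p x) = x"
    using act_inverse[OF assms] by blast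
  have "homeomorphic_maps T T (act p) (act q)"
    unfolding homeomorphic_maps_def topspace_T
    using q continuous_map_act assms by blast
  then have "homeomorphic_map T T (act p)"
    using homeomorphic_map_maps by blast
  moreover have "bij_betw (act p) (carrier P) (carrier P)"
    using q assms act_closed by (intro bij_betw_byWitness[of _ "act q"]) blast+
  then have "act p \<in> Bij (carrier P)"
    by (simp add: Bij_def act_def case_prod_unfold)
  moreover have "act p \<in> Ring.ring_hom P P"
  proof (rule ring_hom_memI)
    interpret P: ring P by (rule ring_P)
    obtain a \<sigma> where p: "p = (a, \<sigma>)" by (metis surj_pair)
    have a: "a \<in> carrier A" and \<sigma>: "\<sigma> \<in> carrier S"
      using assms by (simp_all only: carrier_N p fst_conv snd_conv)
    have eval: "act p x i \<alpha> = a i \<alpha> (x i (inv_into (K i) (\<sigma> i) \<alpha>))"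
      if "x \<in> carrier P" "i \<in> {1..m}" "\<alpha> \<in> K i" for x i \<alpha>
      using that by (simp only: act_apply p fst_conv snd_conv coordwise_index coord_perms_index)
    fix x y assume x: "x \<in> carrier P" and y: "y \<in> carrier P"
    show "act p x \<in> carrier P" by (rule act_closed[OF assms x])
    show "act p (x \<otimes>\<^bsub>P\<^esub> y) = act p x \<otimes>\<^bsub>P\<^esub> act p y"
    proof (rule carrier_P_eqI)
      fix i \<alpha> assume i: "i \<in> {1..m}" "\<alpha> \<in> K i"
      note \<beta> = inv_into_closed[OF \<sigma> i]
      show "act p (x \<otimes>\<^bsub>P\<^esub> y) i \<alpha> = (act p x \<otimes>\<^bsub>P\<^esub> act p y) i \<alpha>"
        unfolding eval[OF P.m_closed[OF x y] i]
        using i \<beta> eval[OF x i] eval[OF y i] ring_hom_mult[OF carrier_AE(1)[OF a i]]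
          carrier_PE[OF x i(1) \<beta>] carrier_PE[OF y i(1) \<beta>] by simp
    qed (intro act_closed assms P.m_closed x y)+
    show "act p (x \<oplus>\<^bsub>P\<^esub> y) = act p x \<oplus>\<^bsub>P\<^esub> act p y"
    proof (rule carrier_P_eqI)
      fix i \<alpha> assume i: "i \<in> {1..m}" "\<alpha> \<in> K i"
      note \<beta> = inv_into_closed[OF \<sigma> i]
      show "act p (x \<oplus>\<^bsub>P\<^esub> y) i \<alpha> = (act p x \<oplus>\<^bsub>P\<^esub> act p y) i \<alpha>"
        unfolding eval[OF P.a_closed[OF x y] i]
        using i \<beta> eval[OF x i] eval[OF y i] ring_hom_add[OF carrier_AE(1)[OF a i]]
          carrier_PE[OF x i(1) \<beta>] carrier_PE[OF y i(1) \<beta>] by simp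
    qed (intro act_closed assms P.a_closed x y)+
  next
    interpret P: ring P by (rule ring_P)
    obtain a \<sigma> where p: "p = (a, \<sigma>)" by (metis surj_pair)
    have a: "a \<in> carrier A" and \<sigma>: "\<sigma> \<in> carrier S"
      using assms by (simp_all only: carrier_N p fst_conv snd_conv)
    show "act p \<one>\<^bsub>P\<^esub> = \<one>\<^bsub>P\<^esub>"
    proof (rule carrier_P_eqI)
      fix i \<alpha> assume i: "i \<in> {1..m}" "\<alpha> \<in> K i"
      have "act p \<one>\<^bsub>P\<^esub> i \<alpha> = a i \<alpha> (\<one>\<^bsub>P\<^esub> i (inv_into (K i) (\<sigma> i) \<alpha>))"
        using i by (simp only: act_apply[OF P.one_closed] p fst_conv snd_conv coordwise_index coord_perms_index)
      then show "act p \<one>\<^bsub>P\<^esub> i \<alpha> = \<one>\<^bsub>P\<^esub> i \<alpha>"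
        using i inv_into_closed[OF \<sigma> i] ring_hom_one[OF carrier_AE(1)[OF a i]] by simp
    qed (intro act_closed assms P.one_closed)+
  qed
  ultimately show ?thesis
    by (simp only: topological_ring_autos_def ring_autos_def mem_Collect_eq Int_iff simp_thms)
qed

section \<open>Reading a topological automorphism off its coordinates\<close>

lemma coordinate_separation:
  assumes i: "i \<in> {1..m}" and \<beta>: "\<beta> \<in> K i" and \<gamma>: "\<gamma> \<in> K i"
    and u: "u \<in> Ring.ring_hom (M i) (M i)" and v: "v \<in> Ring.ring_hom (M i) (M i)"
    and eq: "\<And>x. x \<in> carrier P \<Longrightarrow> u (x i \<beta>) = v (x i \<gamma>)"
  shows "\<beta> = \<gamma>" and "\<And>y. y \<in> carrier (M i) \<Longrightarrow> u y = v y"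
proof -
  have M: "ring (M j)" if "j \<in> {1..m}" for j using ring_M that .
  \<comment> \<open>Test elements supported at the single coordinate \<beta> of type
    \<open>i\<close>. If \<gamma> were another coordinate, the choice of the unit for
    \<open>y\<close> would give \<open>u\<close> of the unit equal to \<open>v\<close> of zero, that
    is, unit equal to zero.\<close>
  define x where "x y = (\<lambda>j\<in>{1..m}. \<lambda>\<delta>\<in>K j. if j = i \<and> \<delta> = \<beta> then y else \<zero>\<^bsub>M j\<^esub>)" for y
  have x: "x y \<in> carrier P" if "y \<in> carrier (M i)" for y
    using that M by (auto simp: x_def ring.ring_simprules)
  show "\<beta> = \<gamma>"
  proof (rule ccontr)
    assume "\<beta> \<noteq> \<gamma>"
    have one: "\<one>\<^bsub>M i\<^esub> \<in> carrier (M i)" using M[OF i] by (simp add: ring.ring_simprules)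
    have "\<one>\<^bsub>M i\<^esub> = u \<one>\<^bsub>M i\<^esub>" using u by (simp add: ring_hom_one)
    also have "\<dots> = v \<zero>\<^bsub>M i\<^esub>"
      using eq[OF x[OF one]] i \<beta> \<gamma> \<open>\<beta> \<noteq> \<gamma>\<close> by (simp add: x_def)
    also have "\<dots> = \<zero>\<^bsub>M i\<^esub>" using ring_hom_zero[OF v M[OF i] M[OF i]] .
    finally show False using one_not_zero_M[OF i] by simp
  qed
  then show "u y = v y" if "y \<in> carrier (M i)" for y
    using eq[OF x[OF that]] i \<beta> by (simp add: x_def)
qed

lemma topological_auto_coordinate:
  assumes h: "h \<in> topological_ring_autos P T" and i: "i \<in> {1..m}" and \<alpha>: "\<alpha> \<in> K i"
  shows "\<exists>\<beta>\<in>K i. \<exists>u\<in>ring_iso (M i) (M i). \<forall>x\<in>carrier P. h x i \<alpha> = u (x i \<beta>)"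
proof -
  let ?Q = "\<lambda>i. product_topology (\<lambda>_. discrete_topology (carrier (M i))) (K i)"
  let ?D = "discrete_topology (carrier (M i))"
  interpret P: ring P by (rule ring_P)
  have hB: "h \<in> Bij (carrier P)" and hom: "h \<in> Ring.ring_hom P P" and "homeomorphic_map T T h"
    using h unfolding topological_ring_autos_def ring_autos_def by blast+
  then have cont: "continuous_map T T h" and img: "h ` carrier P = carrier P"
    by (blast dest: homeomorphic_imp_continuous_map) (use hB in \<open>simp add: Bij_def bij_betw_def\<close>)
  let ?f = "\<lambda>x. h x i \<alpha>"
  have "?f \<in> Ring.ring_hom P (M i)"
  proof (rule ring_hom_memI)
    fix x y assume x: "x \<in> carrier P" and y: "y \<in> carrier P"
    show "?f x \<in> carrier (M i)"
      by (intro carrier_PE[OF _ i \<alpha>] ring_hom_closed[OF hom] x)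
    show "?f (x \<otimes>\<^bsub>P\<^esub> y) = ?f x \<otimes>\<^bsub>M i\<^esub> ?f y"
      unfolding ring_hom_mult[OF hom x y] using i \<alpha> by simp
    show "?f (x \<oplus>\<^bsub>P\<^esub> y) = ?f x \<oplus>\<^bsub>M i\<^esub> ?f y"
      unfolding ring_hom_add[OF hom x y] using i \<alpha> by simp
  next
    show "?f \<one>\<^bsub>P\<^esub> = \<one>\<^bsub>M i\<^esub>"
      unfolding ring_hom_one[OF hom] using i \<alpha> by simp
  qed
  moreover have "?f ` carrier P = carrier (M i)"
  proof
    show "?f ` carrier P \<subseteq> carrier (M i)"
      by (intro image_subsetI carrier_PE[OF _ i \<alpha>] ring_hom_closed[OF hom])
    show "carrier (M i) \<subseteq> ?f ` carrier P"
    proof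
      fix y assume y: "y \<in> carrier (M i)"
      \<comment> \<open>Any element of the product with value \<open>y\<close> at \<alpha> will do;
        surjectivity of \<open>h\<close> supplies its preimage.\<close>
      define x where "x = (\<lambda>j\<in>{1..m}. \<lambda>\<delta>\<in>K j. if j = i then y else \<zero>\<^bsub>M j\<^esub>)"
      have "x \<in> carrier P"
        using y ring_M by (auto simp: x_def ring.ring_simprules)
      then obtain z where "z \<in> carrier P" "x = h z" using img by blast
      moreover have "x i \<alpha> = y" using i \<alpha> by (simp add: x_def)
      ultimately show "y \<in> ?f ` carrier P" by blast
    qed
  qed
  moreover have "continuous_map T ?D ?f"
  proof -
    have "continuous_map T (?Q i) (\<lambda>x. x i)"
      by (rule continuous_map_product_coordinates[OF i])
    with cont have "continuous_map T (?Q i) (\<lambda>x. h x i)"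
      by (rule continuous_map_compose[unfolded comp_def])
    moreover have "continuous_map (?Q i) ?D (\<lambda>y. y \<alpha>)"
      by (rule continuous_map_product_coordinates[OF \<alpha>])
    ultimately show ?thesis
      by (rule continuous_map_compose[unfolded comp_def])
  qed
  \<comment> \<open>The outer product selects the type \<open>j\<close>; the continuity of
    \<open>g\<close> obtained here allows the inner power to select the coordinate \<beta>
    next.\<close>
  ultimately have "\<exists>j\<in>{1..m}. \<exists>g\<in>Ring.ring_hom (product_ring (K j) (\<lambda>_. M j)) (M i).
      g ` carrier (product_ring (K j) (\<lambda>_. M j)) = carrier (M i) \<and> continuous_map (?Q j) ?D g
      \<and> (\<forall>x\<in>carrier P. ?f x = g (x j))"
    by (intro product_ring_hom_factors ring_K simple[OF i]) simp_all
  then obtain j g where j: "j \<in> {1..m}"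
    and g: "g \<in> Ring.ring_hom (product_ring (K j) (\<lambda>_. M j)) (M i)"
      "g ` carrier (product_ring (K j) (\<lambda>_. M j)) = carrier (M i)" "continuous_map (?Q j) ?D g"
    and fg: "\<forall>x\<in>carrier P. ?f x = g (x j)"
    by (elim bexE conjE)
  have "\<exists>\<beta>\<in>K j. \<exists>u\<in>Ring.ring_hom (M j) (M i). u ` carrier (M j) = carrier (M i)
      \<and> continuous_map (discrete_topology (carrier (M j))) ?D u
      \<and> (\<forall>y\<in>carrier (product_ring (K j) (\<lambda>_. M j)). g y = u (y \<beta>))"
    by (rule product_ring_hom_factors[OF ring_M[OF j] _ simple[OF i] g]) simp
  then obtain \<beta> u where \<beta>: "\<beta> \<in> K j" and u: "u \<in> Ring.ring_hom (M j) (M i)"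
      "u ` carrier (M j) = carrier (M i)"
    and gu: "\<forall>y\<in>carrier (product_ring (K j) (\<lambda>_. M j)). g y = u (y \<beta>)"
    by (elim bexE conjE)
  have "inj_on u (carrier (M j))"
    using simple_ring_hom_inj[OF simple[OF j] ring_M[OF i] one_not_zero_M[OF i] u(1)] .
  then have iso: "u \<in> ring_iso (M j) (M i)"
    using u by (simp add: ring_iso_def bij_betw_def)
  then have "j = i"
    using distinct[OF j i] by (auto simp: is_ring_iso_def)
  have "h x i \<alpha> = u (x i \<beta>)" if "x \<in> carrier P" for x
  proof -
    have "x j \<in> carrier (product_ring (K j) (\<lambda>_. M j))"
      using that j by (auto simp: PiE_iff)
    then show ?thesis using bspec[OF fg that] bspec[OF gu, of "x j"] \<open>j = i\<close> by (simp only:)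
  qed
  then show ?thesis using \<beta> iso \<open>j = i\<close> by blast
qed

lemma topological_auto_coordinates:
  assumes h: "h \<in> topological_ring_autos P T"
  shows "\<exists>s u. \<forall>i\<in>{1..m}. \<forall>\<alpha>\<in>K i. s i \<alpha> \<in> K i \<and> u i \<alpha> \<in> ring_iso (M i) (M i) \<and>
    (\<forall>x\<in>carrier P. h x i \<alpha> = u i \<alpha> (x i (s i \<alpha>)))"
proof -
  let ?Q = "\<lambda>i \<alpha> p. fst p \<in> K i \<and> snd p \<in> ring_iso (M i) (M i)
    \<and> (\<forall>x\<in>carrier P. h x i \<alpha> = snd p (x i (fst p)))"
  define p where "p i \<alpha> = (SOME p. ?Q i \<alpha> p)" for i \<alpha>
  have "?Q i \<alpha> (p i \<alpha>)" if i: "i \<in> {1..m}" and \<alpha>: "\<alpha> \<in> K i" for i \<alpha>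
    unfolding p_def
  proof (rule someI_ex)
    obtain \<beta> u where "\<beta> \<in> K i" "u \<in> ring_iso (M i) (M i)" "\<forall>x\<in>carrier P. h x i \<alpha> = u (x i \<beta>)"
      using topological_auto_coordinate[OF h i \<alpha>] by blast
    then have "?Q i \<alpha> (\<beta>, u)" by (simp only: fst_conv snd_conv simp_thms)
    then show "\<exists>p. ?Q i \<alpha> p" ..
  qed
  then show ?thesis by (intro exI ballI)
qed

lemma topological_auto_eq_act:
  assumes h: "h \<in> topological_ring_autos P T"
  shows "h \<in> act ` carrier N"
proof -
  define k where "k = (\<lambda>x\<in>carrier P. inv_into (carrier P) h x)"
  have hB: "h \<in> Bij (carrier P)"
    using h unfolding topological_ring_autos_def ring_autos_def by blast
  then have inj: "inj_on h (carrier P)" and img: "h ` carrier P = carrier P"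
    by (auto simp only: Bij_def bij_betw_def)
  have k: "k \<in> topological_ring_autos P T"
    using subgroup.m_inv_closed[OF subgroup_topological_ring_autos[OF ring_P topspace_T] h]
    unfolding inv_BijGroup[OF hB] k_def .
  have closed: "h x \<in> carrier P" "k x \<in> carrier P" if "x \<in> carrier P" for x
    using that img inv_into_into[of x h "carrier P"] by (simp_all only: k_def restrict_apply if_True) blast+
  have hk: "h (k x) = x" "k (h x) = x" if "x \<in> carrier P" for x
    using that img closed[OF that] f_inv_into_f[of x h "carrier P"] inv_into_f_f[OF inj that]
    by (simp_all only: k_def restrict_apply if_True)
  obtain s u where "\<forall>i\<in>{1..m}. \<forall>\<alpha>\<in>K i.
      s i \<alpha> \<in> K i \<and> u i \<alpha> \<in> ring_iso (M i) (M i) \<and> (\<forall>x\<in>carrier P. h x i \<alpha> = u i \<alpha> (x i (s i \<alpha>)))"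
    using topological_auto_coordinates[OF h] by (elim exE)
  note su = bspec[OF bspec[OF this]]
  obtain t v where "\<forall>i\<in>{1..m}. \<forall>\<alpha>\<in>K i.
      t i \<alpha> \<in> K i \<and> v i \<alpha> \<in> ring_iso (M i) (M i) \<and> (\<forall>x\<in>carrier P. k x i \<alpha> = v i \<alpha> (x i (t i \<alpha>)))"
    using topological_auto_coordinates[OF k] by (elim exE)
  note tv = bspec[OF bspec[OF this]]
  have id: "(\<lambda>y. y) \<in> Ring.ring_hom (M i) (M i)" for i
    by (auto intro: ring_hom_memI)
  \<comment> \<open>Reading \<open>h (k x) = x\<close> at \<alpha> expresses
    \<open>x i \<alpha>\<close> through the coordinate \<open>t i (s i \<alpha>)\<close> alone.
    Comparison with the identity homomorphism by \<open>coordinate_separation\<close> identifies the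
    two coordinates.\<close>
  have ts: "t i (s i \<alpha>) = \<alpha>" if i: "i \<in> {1..m}" and \<alpha>: "\<alpha> \<in> K i" for i \<alpha>
  proof (rule coordinate_separation(1)[OF i _ \<alpha> _ id])
    note s = su[OF i \<alpha>] and t = tv[OF i conjunct1[OF su[OF i \<alpha>]]]
    show "t i (s i \<alpha>) \<in> K i" using t by blast
    show "u i \<alpha> \<circ> v i (s i \<alpha>) \<in> Ring.ring_hom (M i) (M i)"
      using s t by (intro ring_hom_trans[of _ "M i" "M i"]) (auto simp: ring_iso_def)
    show "(u i \<alpha> \<circ> v i (s i \<alpha>)) (x i (t i (s i \<alpha>))) = x i \<alpha>" if "x \<in> carrier P" for x
    proof -
      have "h (k x) i \<alpha> = u i \<alpha> (k x i (s i \<alpha>))"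
        using s closed(2)[OF that] by blast
      moreover have "k x i (s i \<alpha>) = v i (s i \<alpha>) (x i (t i (s i \<alpha>)))"
        using t that by blast
      ultimately show ?thesis
        by (simp only: comp_apply hk(1)[OF that])
    qed
  qed
  have st: "s i (t i \<alpha>) = \<alpha>" if i: "i \<in> {1..m}" and \<alpha>: "\<alpha> \<in> K i" for i \<alpha>
  proof (rule coordinate_separation(1)[OF i _ \<alpha> _ id])
    note t = tv[OF i \<alpha>] and s = su[OF i conjunct1[OF tv[OF i \<alpha>]]]
    show "s i (t i \<alpha>) \<in> K i" using s by blast
    show "v i \<alpha> \<circ> u i (t i \<alpha>) \<in> Ring.ring_hom (M i) (M i)"
      using s t by (intro ring_hom_trans[of _ "M i" "M i"]) (auto simp: ring_iso_def)
    show "(v i \<alpha> \<circ> u i (t i \<alpha>)) (x i (s i (t i \<alpha>))) = x i \<alpha>" if "x \<in> carrier P" for x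
    proof -
      have "k (h x) i \<alpha> = v i \<alpha> (h x i (t i \<alpha>))"
        using t closed(1)[OF that] by blast
      moreover have "h x i (t i \<alpha>) = u i (t i \<alpha>) (x i (s i (t i \<alpha>)))"
        using s that by blast
      ultimately show ?thesis
        by (simp only: comp_apply hk(2)[OF that])
    qed
  qed
  \<comment> \<open>\<open>act\<close> reads its argument at the inverse of \<sigma>, and
    \<open>h\<close> reads at \<open>s\<close>. Hence \<sigma> has to be the inverse of
    \<open>s\<close>, which is \<open>t\<close>. The restrictions make both components extensional,
    as the carriers demand.\<close>
  define \<sigma> where "\<sigma> = (\<lambda>i\<in>{1..m}. \<lambda>\<alpha>\<in>K i. t i \<alpha>)"
  define a where "a = (\<lambda>i\<in>{1..m}. \<lambda>\<alpha>\<in>K i. \<lambda>y\<in>carrier (M i). u i \<alpha> y)"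
  have bij: "bij_betw (\<sigma> i) (K i) (K i)" if "i \<in> {1..m}" for i
    using that su tv st ts by (intro bij_betw_byWitness[of _ "s i"]) (auto simp: \<sigma>_def)
  then have \<sigma>: "\<sigma> \<in> carrier S"
    unfolding carrier_S by (auto simp: Bij_def) (auto simp: \<sigma>_def)
  have inv_\<sigma>: "inv_into (K i) (\<sigma> i) \<alpha> = s i \<alpha>" if "i \<in> {1..m}" "\<alpha> \<in> K i" for i \<alpha>
    using that bij[OF that(1)] su[OF that] ts[OF that]
    by (intro inv_into_f_eq) (auto simp: \<sigma>_def bij_betw_def)
  have "a i \<alpha> \<in> ring_autos (M i)" if "i \<in> {1..m}" "\<alpha> \<in> K i" for i \<alpha>
  proof -
    have "a i \<alpha> \<in> ring_iso (M i) (M i)"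
      by (rule ring.ring_iso_restrict[OF ring_M, of i "u i \<alpha>"]) (use su[OF that] that in \<open>auto simp: a_def\<close>)
    then show ?thesis
      using that by (auto simp: ring_iso_def ring_autos_def Bij_def a_def)
  qed
  then have "a \<in> carrier A"
    by (auto simp: ring_auto_group_def) (auto simp: a_def)
  with \<sigma> have p: "(a, \<sigma>) \<in> carrier N"
    by (simp only: carrier_N fst_conv snd_conv)
  have "h = act (a, \<sigma>)"
  proof (rule extensionalityI[of _ "carrier P"])
    show "h \<in> extensional (carrier P)" using hB by (rule Bij_imp_extensional)
    show "act (a, \<sigma>) \<in> extensional (carrier P)" by (simp only: act_def prod.case restrict_extensional)
    fix x assume x: "x \<in> carrier P"
    show "h x = act (a, \<sigma>) x"
    proof (rule carrier_P_eqI[OF closed(1)[OF x] act_closed[OF p x]])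
      fix i \<alpha> assume i: "i \<in> {1..m}" and \<alpha>: "\<alpha> \<in> K i"
      have "s i \<alpha> \<in> K i" "h x i \<alpha> = u i \<alpha> (x i (s i \<alpha>))" using su[OF i \<alpha>] x by blast+
      moreover have "act (a, \<sigma>) x i \<alpha> = a i \<alpha> (x i (s i \<alpha>))"
        using i \<alpha> by (simp only: act_apply[OF x] fst_conv snd_conv coordwise_index
            coord_perms_index inv_\<sigma>)
      ultimately show "h x i \<alpha> = act (a, \<sigma>) x i \<alpha>"
        using i \<alpha> carrier_PE[OF x i] by (simp add: a_def)
    qed
  qed
  then show ?thesis using p by blast
qed

section \<open>The automorphism group as a semidirect product\<close>

lemma topological_ring_autos_eq: "topological_ring_autos P T = act ` carrier N"
  using topological_auto_eq_act act_in_topological_ring_autos by blast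

text \<open>Equal actions read the same coordinate through the same map, by
  \<open>coordinate_separation\<close>. Extensionality of all components turns agreement on the
  carriers into equality.\<close>

lemma inj_on_act: "inj_on act (carrier N)"
proof (rule inj_onI)
  fix p q assume p: "p \<in> carrier N" and q: "q \<in> carrier N" and eq: "act p = act q"
  obtain a \<sigma> b \<tau> where pq: "p = (a, \<sigma>)" "q = (b, \<tau>)" by (metis surj_pair)
  have in_carrier: "a \<in> carrier A" "b \<in> carrier A" "\<sigma> \<in> carrier S" "\<tau> \<in> carrier S"
    using p q by (simp_all only: carrier_N pq fst_conv snd_conv)
  have same: "inv_into (K i) (\<sigma> i) \<alpha> = inv_into (K i) (\<tau> i) \<alpha>"
      "\<And>y. y \<in> carrier (M i) \<Longrightarrow> a i \<alpha> y = b i \<alpha> y"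
    if i: "i \<in> {1..m}" and \<alpha>: "\<alpha> \<in> K i" for i \<alpha>
  proof -
    have agree: "a i \<alpha> (x i (inv_into (K i) (\<sigma> i) \<alpha>)) = b i \<alpha> (x i (inv_into (K i) (\<tau> i) \<alpha>))"
      if x: "x \<in> carrier P" for x
    proof -
      have "act p x i \<alpha> = act q x i \<alpha>" using eq by simp
      then show ?thesis
        using i \<alpha> by (simp only: act_apply[OF x] pq fst_conv snd_conv coordwise_index coord_perms_index)
    qed
    note sep = coordinate_separation[OF i inv_into_closed[OF in_carrier(3) i \<alpha>]
        inv_into_closed[OF in_carrier(4) i \<alpha>] carrier_AE(1)[OF in_carrier(1) i \<alpha>]
        carrier_AE(1)[OF in_carrier(2) i \<alpha>]]
    show "inv_into (K i) (\<sigma> i) \<alpha> = inv_into (K i) (\<tau> i) \<alpha>"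
      by (rule sep(1)) (rule agree)
    show "a i \<alpha> y = b i \<alpha> y" if "y \<in> carrier (M i)" for y
      by (rule sep(2)[OF _ that]) (rule agree)
  qed
  have "\<sigma> i = \<tau> i" if i: "i \<in> {1..m}" for i
  proof (rule extensionalityI[of _ "K i"])
    note B = carrier_SE[OF in_carrier(3) i] carrier_SE[OF in_carrier(4) i]
    show "\<sigma> i \<in> extensional (K i)" "\<tau> i \<in> extensional (K i)"
      using B by (simp_all add: Bij_def)
    fix \<alpha> assume \<alpha>: "\<alpha> \<in> K i"
    have \<tau>\<alpha>: "\<tau> i \<alpha> \<in> K i" using B(2) \<alpha> by (auto dest: Bij_imp_funcset)
    \<comment> \<open>Only the inverses are known to agree. Evaluating them at
      \<open>\<tau> i \<alpha>\<close> gives \<alpha>, and applying \<open>\<sigma> i\<close>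
      recovers the permutations themselves.\<close>
    have "inv_into (K i) (\<sigma> i) (\<tau> i \<alpha>) = inv_into (K i) (\<tau> i) (\<tau> i \<alpha>)"
      by (rule same(1)[OF i \<tau>\<alpha>])
    also have "\<dots> = \<alpha>" using B(2) \<alpha> by (auto simp: Bij_def bij_betw_def)
    finally have "\<sigma> i (inv_into (K i) (\<sigma> i) (\<tau> i \<alpha>)) = \<sigma> i \<alpha>" by simp
    moreover have "\<sigma> i (inv_into (K i) (\<sigma> i) (\<tau> i \<alpha>)) = \<tau> i \<alpha>"
      using B(1) \<tau>\<alpha> by (intro f_inv_into_f) (auto simp: Bij_def bij_betw_def)
    ultimately show "\<sigma> i \<alpha> = \<tau> i \<alpha>" by simp
  qed
  then have "\<sigma> = \<tau>"
    using in_carrier(3,4) by (intro extensionalityI[of _ "{1..m}"]) (auto simp: carrier_S PiE_iff)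
  moreover have "a i \<alpha> = b i \<alpha>" if "i \<in> {1..m}" "\<alpha> \<in> K i" for i \<alpha>
    using same(2)[OF that] carrier_AE(2)[OF in_carrier(1) that] carrier_AE(2)[OF in_carrier(2) that]
    by (intro extensionalityI[of _ "carrier (M i)"]) (auto simp: Bij_def)
  then have "a i = b i" if "i \<in> {1..m}" for i
    using in_carrier(1,2) that by (intro extensionalityI[of _ "K i"]) (auto simp: PiE_iff)
  then have "a = b"
    using in_carrier(1,2) by (intro extensionalityI[of _ "{1..m}"]) (auto simp: PiE_iff)
  ultimately show "p = q" by (simp add: pq)
qed

lemma act_hom: "act \<in> hom N (topological_ring_auto_group P T)"
proof (rule homI)
  fix p q assume p: "p \<in> carrier N" and q: "q \<in> carrier N"
  have B: "act p \<in> Bij (carrier P)" "act q \<in> Bij (carrier P)"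
    using act_in_topological_ring_autos[OF p] act_in_topological_ring_autos[OF q]
    unfolding topological_ring_autos_def ring_autos_def by blast+
  have "act (p \<otimes>\<^bsub>N\<^esub> q) = compose (carrier P) (act p) (act q)"
  proof (rule extensionalityI[of _ "carrier P"])
    show "act (p \<otimes>\<^bsub>N\<^esub> q) \<in> extensional (carrier P)"
      by (simp only: act_def case_prod_unfold restrict_extensional)
    show "act (p \<otimes>\<^bsub>N\<^esub> q) x = compose (carrier P) (act p) (act q) x" if "x \<in> carrier P" for x
      using act_mult[OF p q that] that by (simp only: compose_eq)
  qed (rule compose_extensional)
  also have "\<dots> = act p \<otimes>\<^bsub>topological_ring_auto_group P T\<^esub> act q"
    using B by (simp add: topological_ring_auto_group_def BijGroup_def del: product_ring_simps)
  finally show "act (p \<otimes>\<^bsub>N\<^esub> q) = act p \<otimes>\<^bsub>topological_ring_auto_group P T\<^esub> act q" .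
qed (simp add: topological_ring_auto_group_def act_in_topological_ring_autos
    del: product_ring_simps)

lemma topological_ring_auto_group_iso: "topological_ring_auto_group P T \<cong> N"
proof (rule iso_of_bij_hom[OF act_hom])
  show "bij_betw act (carrier N) (carrier (topological_ring_auto_group P T))"
    using inj_on_act topological_ring_autos_eq
    by (simp add: bij_betw_def topological_ring_auto_group_def del: product_ring_simps)
qed (rule N_closed)

text \<open>For fixed \<sigma>, twisting by \<sigma> maps the families of automorphisms onto
  themselves, so exchanging the order of composition changes the parameters but not the set of
  maps.\<close>

lemma act_image_eq:
  "act ` carrier N
     = {compose (carrier P) (coord_perms m K \<sigma>) (coordwise m K g) | \<sigma> g.
          \<sigma> \<in> carrier S \<and> g \<in> carrier A}" (is "_ = ?B")
proof -
  interpret S: group S by (rule group_S)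
  have swap: "compose (carrier P) (coord_perms m K \<sigma>) (coordwise m K g)
      = act (coord_perms m K \<sigma> g, \<sigma>)" if "\<sigma> \<in> carrier S" "g \<in> carrier A" for \<sigma> g
    unfolding compose_def act_def prod.case
    by (intro restrict_ext coord_perms_coordwise that)
  show ?thesis
  proof (intro equalityI subsetI)
    fix f assume "f \<in> ?B"
    then obtain \<sigma> g where \<sigma>: "\<sigma> \<in> carrier S" and g: "g \<in> carrier A"
      and f: "f = compose (carrier P) (coord_perms m K \<sigma>) (coordwise m K g)" by blast
    show "f \<in> act ` carrier N"
      unfolding f swap[OF \<sigma> g]
      using \<sigma> g by (intro imageI) (simp only: carrier_N fst_conv snd_conv coord_perms_A)
  next
    fix f assume "f \<in> act ` carrier N"
    then obtain a \<sigma> where p: "(a, \<sigma>) \<in> carrier N" and f: "f = act (a, \<sigma>)" by auto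
    have a: "a \<in> carrier A" and \<sigma>: "\<sigma> \<in> carrier S"
      using p by (simp_all only: carrier_N fst_conv snd_conv)
    have A_ext: "a \<in> (\<Pi>\<^sub>E i\<in>{1..m}. \<Pi>\<^sub>E \<alpha>\<in>K i. carrier (ring_auto_group (M i)))"
      using a by (simp only: carrier_product_group)
    \<comment> \<open>Chosen so that moving it past \<sigma> gives back \<open>a\<close>.\<close>
    let ?g = "coord_perms m K (inv\<^bsub>S\<^esub> \<sigma>) a"
    have g: "?g \<in> carrier A" by (intro coord_perms_A S.inv_closed a \<sigma>)
    have "coord_perms m K \<sigma> ?g = coord_perms m K (\<sigma> \<otimes>\<^bsub>S\<^esub> inv\<^bsub>S\<^esub> \<sigma>) a"
      using \<sigma> by (simp only: coord_perms_mult S.inv_closed)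
    also have "\<dots> = a"
      using \<sigma> coord_perms_one[OF A_ext] by (simp only: S.r_inv)
    finally have "f = compose (carrier P) (coord_perms m K \<sigma>) (coordwise m K ?g)"
      unfolding swap[OF \<sigma> g] f by (simp only:)
    then show "f \<in> ?B" using \<sigma> g by blast
  qed
qed

end

theorem corollary3p4:
  fixes m :: nat
    and F :: "nat \<Rightarrow> ('a, 'b) ring_scheme"
    and n :: "nat \<Rightarrow> nat"
    and K :: "nat \<Rightarrow> 'k set"
  assumes "\<And>i. i \<in> {1..m} \<Longrightarrow> field (F i)"
    and "\<And>i. i \<in> {1..m} \<Longrightarrow> finite (carrier (F i))"
    and "\<And>i. i \<in> {1..m} \<Longrightarrow> n i \<ge> 1"
    and "\<And>i j. i \<in> {1..m} \<Longrightarrow> j \<in> {1..m} \<Longrightarrow> i \<noteq> j \<Longrightarrow>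
           \<not> matrix_ring (F i) (n i) \<simeq> matrix_ring (F j) (n j)"
  shows "topological_ring_autos (matrix_product_ring m F n K) (matrix_product_topology m F n K)
           = permuted_coordwise_autos m F n K
    \<and> topological_ring_auto_group (matrix_product_ring m F n K) (matrix_product_topology m F n K)
        \<cong> semidirect_product (Aut_product m F n K) (Sym_product m K) (coord_perms m K)
    \<and> (\<forall>(G :: 'g monoid) S \<phi>.
         small_compact_G_ring (matrix_product_ring m F n K) (matrix_product_topology m F n K) G S \<phi>
         \<longrightarrow> subgroup (\<phi> ` carrier G)
               (topological_ring_auto_group
                 (matrix_product_ring m F n K) (matrix_product_topology m F n K))
             \<and> subgroup (\<phi> ` carrier G)
               (BijGroup (carrier (matrix_product_ring m F n K))
                 \<lparr>carrier := permuted_coordwise_autos m F n K\<rparr>))"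
proof -
  interpret simple_ring_powers m "\<lambda>i. matrix_ring (F i) (n i)" K
    by unfold_locales (use assms field.simple_matrix_ring in blast)+
  have autos: "topological_ring_autos (matrix_product_ring m F n K) (matrix_product_topology m F n K)
      = permuted_coordwise_autos m F n K"
    unfolding permuted_coordwise_autos_def matrix_product_ring_def matrix_product_topology_def
      Aut_product_def topological_ring_autos_eq act_image_eq ..
  have iso: "topological_ring_auto_group (matrix_product_ring m F n K) (matrix_product_topology m F n K)
      \<cong> semidirect_product (Aut_product m F n K) (Sym_product m K) (coord_perms m K)"
    unfolding matrix_product_ring_def matrix_product_topology_def Aut_product_def
    by (rule topological_ring_auto_group_iso)
  have "subgroup (\<phi> ` carrier G) (topological_ring_auto_group
      (matrix_product_ring m F n K) (matrix_product_topology m F n K))"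
    if "small_compact_G_ring (matrix_product_ring m F n K) (matrix_product_topology m F n K) G S \<phi>"
    for G :: "'g monoid" and S \<phi>
    using that
    by (intro compact_G_ring.subgroup_image_topological_ring_autos small_compact_G_ring.axioms)
  then show ?thesis
    \<comment> \<open>By \<open>autos\<close> the two ambient groups of the last claim have the same
      carrier, so one subgroup fact yields both.\<close>
    using autos iso by (simp only: topological_ring_auto_group_def) blast
qed

end
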